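(* Let $\mathcal{OF}$ denote the class of TM implementations (for $n$ processes) that provide obstruction-free (OF) TM-progress and OF TM-liveness. Every read-write disjoint-access parallel (RW DAP) opaque TM implementation $M\in\mathcal{OF}$ has an execution $E$ in which some read-only transaction $T\in\mathrm{txns}(E)$ performs $\Omega(n)$ non-overlapping RAWs or AWARs.
   Context: **Model.** A transactional memory (TM) lets processes access a set of data items (t-objects) via transactions. Each transaction $T_k$ has a unique identifier $k$ and may perform t-operations, each a matching pair of an invocation and a response: $\mathrm{read}_k(X)$ returns a value in the set $V$ of values or the special value $A_k\notin V$ (abort); $\mathrm{write}_k(X,v)$, $v\in V$, returns $ok$ or $A_k$; $\mathrm{tryC}_k$ returns $C_k\notin V$ (commit) or $A_k$. The system is asynchronous shared memory with $n$ processes; a process starts a new transaction only after its previous one has committed or aborted. A TM implementation gives processes deterministic algorithms implementing t-operations by applying primitives to shared base objects, each with an initial value. A primitive is a read-modify-write (RMW) procedure $\langle g,h\rangle$: from the current state of the base object, $g$ computes the new state and $h$ the response. A primitive is trivial if it never changes the value of the base object to which it is applied, otherwise nontrivial. An event (step) of $T_k$ is an invocation or response of a t-operation of $T_k$, or a RMW primitive applied by $T_k$ to a base object together with its response; an event is (non)trivial if it applies a (non)trivial primitive. A configuration gives the value of each base object and the state of each process. An execution fragment is a finite or infinite sequence of events; an execution of implementation $M$ is an execution fragment where, starting from the initial configuration, each event is issued according to $M$ and each RMW response matches the state of the base object resulting from all preceding events. $E|k$ is the subsequence of $E$ of events of $T_k$; $\mathrm{txns}(E)$ is the set of transactions with events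 in $E$. Executions are well-formed: for every $T_k$, $E|k$ begins with an invocation of a t-operation, invocations in it are followed by their matching response before the next invocation, and it has no events after $A_k$ or $C_k$. The history of $E$ is its subsequence of invocations and responses of t-operations; histories $H,H'$ are equivalent if $\mathrm{txns}(H)=\mathrm{txns}(H')$ and $H|k=H'|k$ for every $T_k\in\mathrm{txns}(H)$. $\mathrm{Rset}(T_k)$ (resp. $\mathrm{Wset}(T_k)$) in $E$ is the set of t-objects $X$ for which $E$ contains an invocation of $\mathrm{read}_k(X)$ (resp. $\mathrm{write}_k(X,v)$); $\mathrm{Dset}(T_k)=\mathrm{Rset}(T_k)\cup\mathrm{Wset}(T_k)$. $T_k$ is read-only if $\mathrm{Wset}(T_k)=\emptyset$. Data sets are not known a priori (dynamic transactions). $T_k$ is complete in $E$ if $E|k$ ends with a response, t-complete if $E|k$ ends with $A_k$ or $C_k$, committed (aborted) if its last event is $C_k$ ($A_k$). $E$ is t-complete if all its transactions are. $T_k\prec^{RT}_E T_m$ (real-time order) if $T_k$ is t-complete in $E$ and its last event precedes the first event of $T_m$. Two transactions are concurrent in $E$ if neither precedes the other in real-time order; $E$ is t-sequential if no two transactions are concurrent. Two events of $E$ contend on base object $b$ if both are events on $b$ and at least one is nontrivial; two transactions contend on $b$ in $E$ if they have events in $E$ that contend on $b$. An execution fragment is step contention-free for a t-operation $op_k$ (resp. for $T_k$) if the events of $op_k$ (resp. of $T_k$) are contiguous in it. **Opacity.** Executions are assumed to begin with an imaginary committed transaction writing initial values to all t-objects. In a t-sequential history, the latest written value of $X$ for $\mathrm{read}_k(X)$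 is the value of the latest preceding write to $X$ by $T_k$ itself if any, otherwise the value of the latest write to $X$ by a committed transaction preceding $T_k$. A t-sequential history is legal if every $\mathrm{read}_k(X)$ not returning $A_k$ returns the latest written value. A completion $\bar H$ of $H$ is obtained by: for every incomplete t-operation $op_k$, if it is a read or write, inserting $A_k$ somewhere after its invocation, and if it is $\mathrm{tryC}_k$, inserting $C_k$ or $A_k$ somewhere after the last event of $T_k$; and for every complete but not t-complete $T_k$, inserting $\mathrm{tryC}_k\cdot A_k$ somewhere after the last event of $T_k$. A finite history $H$ is opaque if there is a legal t-complete t-sequential history $S$ such that (1) for any $T_k,T_m\in\mathrm{txns}(H)$, $T_k\prec^{RT}_H T_m$ implies $T_k$ precedes $T_m$ in $S$, and (2) $S$ is equivalent to a completion of $H$. $M$ is opaque if the history of each of its finite executions is. **OF TM-liveness.** For every finite execution $E$ of $M$ and every $T_k$ that applies the invocation of a t-operation $op_k$ immediately after $E$, the finite step contention-free extension for $op_k$ contains a matching response. **OF TM-progress.** For every execution $E$ of $M$, if some $T_k\in\mathrm{txns}(E)$ returns $A_k$ in $E$, then $E$ is not step contention-free for $T_k$. **RW DAP.** $\tau_E(T_i,T_j)$ is the set of transactions (including $T_i,T_j$) concurrent to at least one of $T_i,T_j$ in $E$. $\tilde G(T_i,T_j,E)$ is the undirected graph with vertex set $\bigcup_{T\in\tau_E(T_i,T_j)}\mathrm{Dset}(T)$ and an edge between $X$ and $Y$ iff some $T\in\tau_E(T_i,T_j)$ has $\{X,Y\}\subseteq\mathrm{Wset}(T)$. $T_i,T_j$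 are read-write disjoint-access in $E$ if there is no path between a t-object in $\mathrm{Dset}(T_i)$ and one in $\mathrm{Dset}(T_j)$ in $\tilde G(T_i,T_j,E)$. $M$ is RW DAP if, for all executions $E$ of $M$, $T_i$ and $T_j$ contend on the same base object in $E$ only if they are not read-write disjoint-access in $E$ or $\mathrm{Dset}(T_i)\cap\mathrm{Dset}(T_j)\neq\emptyset$. **RAW/AWAR.** Let $\pi^i$ be the $i$-th event of an execution $\pi$ ($i=0,\dots,|\pi|-1$). $T$ performs a RAW (read-after-write) in $\pi$ if there are $0\le i<j<|\pi|$ such that $\pi^i$ is a write to a base object $b$ by $T$, $\pi^j$ is a read of a base object $b'\ne b$ by $T$, and no $\pi^k$ with $i<k<j$ is a write to $b'$ by $T$. Two RAWs are non-overlapping if the read performed by one precedes the write performed by the other. $T$ performs an AWAR (atomic-write-after-read) in $\pi$ if some event $\pi^i$ is the application by $T$ of a nontrivial primitive that atomically reads a base object $b$ and writes to $b$.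
   Formalization: The formal statement additionally assumes that the value set V has at least two elements and that there are at least n (or infinitely many) t-objects; without these the claim fails, e.g. for a TM with a single t-object. *)

theory Defs
  imports Complex_Main "HOL-Library.Landau_Symbols" "HOL-Library.Sublist"
begin

section \<open>Transactions, t-operations and events\<close>

text \<open>
  A transaction identifier is a pair of the process that runs the transaction and an identifier
  that is unique among the transactions of this process.
\<close>

type_synonym tid = "nat \<times> nat"

abbreviation proc_of :: "tid \<Rightarrow> nat" where
  "proc_of k \<equiv> fst k"

datatype ('x, 'v) t_op = Read 'x | Write 'x 'v | TryC

datatype 'v t_res = Val 'v | Ok | Commit | Abort

fun matching :: "('x, 'v) t_op \<Rightarrow> 'v t_res \<Rightarrow> bool" where
  "matching (Read X) r \<longleftrightarrow> (\<exists>v. r = Val v) \<or> r = Abort"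
| "matching (Write X v) r \<longleftrightarrow> r = Ok \<or> r = Abort"
| "matching TryC r \<longleftrightarrow> r = Commit \<or> r = Abort"

fun op_objs :: "('x, 'v) t_op \<Rightarrow> 'x set" where
  "op_objs (Read X) = {X}"
| "op_objs (Write X v) = {X}"
| "op_objs TryC = {}"

text \<open>
  A read-modify-write primitive \<open>(g, h)\<close>: \<open>g\<close> computes the new state of the base object and \<open>h\<close>
  the response, both from the current state.
\<close>

type_synonym ('s, 'r) prim = "('s \<Rightarrow> 's) \<times> ('s \<Rightarrow> 'r)"

definition trivial_prim :: "('s, 'r) prim \<Rightarrow> bool" where
  "trivial_prim pr \<longleftrightarrow> (\<forall>s. fst pr s = s)"

abbreviation nontrivial_prim :: "('s, 'r) prim \<Rightarrow> bool" where
  "nontrivial_prim pr \<equiv> \<not> trivial_prim pr"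

text \<open>
  A primitive reads the base object if its response depends on the current state, or if it
  writes a state that depends on the current one. Hence a plain write (\<open>g\<close> and \<open>h\<close> constant) does
  not read, and neither does a trivial primitive with a constant response.
\<close>

definition reading_prim :: "('s, 'r) prim \<Rightarrow> bool" where
  "reading_prim pr \<longleftrightarrow>
     (\<exists>s s'. snd pr s \<noteq> snd pr s') \<or>
     (nontrivial_prim pr \<and> (\<exists>s s'. fst pr s \<noteq> fst pr s'))"

text \<open>In \<open>Prim b pr r\<close>, the primitive \<open>pr\<close> is applied to the base object \<open>b\<close> with response \<open>r\<close>.\<close>

datatype ('b, 's, 'r, 'x, 'v) act =
  Inv "('x, 'v) t_op"
| Resp "'v t_res"
| Prim 'b "('s, 'r) prim" 'r

type_synonym ('b, 's, 'r, 'x, 'v) event = "tid \<times> ('b, 's, 'r, 'x, 'v) act"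

text \<open>
  Executions are finite here. Nothing is lost: an infinite sequence of events is an execution iff
  its finite prefixes are, and both TM-progress and disjoint-access parallelism hold for an
  infinite execution as soon as they hold for its finite prefixes (an aborted transaction has
  finitely many events; contention occurs in a finite prefix, and data sets and concurrency of
  the transactions in a prefix persist in every extension).
\<close>

type_synonym ('b, 's, 'r, 'x, 'v) exec = "('b, 's, 'r, 'x, 'v) event list"


section \<open>Implementations and their executions\<close>

datatype ('b, 's, 'r, 'v) command = Apply 'b "('s, 'r) prim" | Return "'v t_res"

text \<open>
  The algorithm of process \<open>p\<close> is a deterministic automaton on local states of type \<open>'l\<close>:
  \<open>next_cmd M p\<close> tells what the process does next while a t-operation is pending; the functions
  \<open>on_inv\<close>, \<open>on_prim\<close> and \<open>on_return\<close> update the local state on the invocation of a t-operation,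
  on the response of a primitive, and on the response of a t-operation, respectively.
\<close>

record ('l, 'b, 's, 'r, 'x, 'v) tm =
  nprocs :: nat
  tobjs :: "'x set"
  tobj_init :: "'x \<Rightarrow> 'v"
  base_init :: "'b \<Rightarrow> 's"
  proc_init :: "nat \<Rightarrow> 'l"
  on_inv :: "tid \<Rightarrow> ('x, 'v) t_op \<Rightarrow> 'l \<Rightarrow> 'l"
  next_cmd :: "nat \<Rightarrow> 'l \<Rightarrow> ('b, 's, 'r, 'v) command"
  on_prim :: "nat \<Rightarrow> 'r \<Rightarrow> 'l \<Rightarrow> 'l"
  on_return :: "nat \<Rightarrow> 'l \<Rightarrow> 'l"

record ('l, 'b, 's) config =
  base_state :: "'b \<Rightarrow> 's"
  proc_state :: "nat \<Rightarrow> 'l"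

definition init_config :: "('l, 'b, 's, 'r, 'x, 'v) tm \<Rightarrow> ('l, 'b, 's) config" where
  "init_config M = \<lparr>base_state = base_init M, proc_state = proc_init M\<rparr>"

fun issued ::
  "('l, 'b, 's, 'r, 'x, 'v) tm \<Rightarrow> ('l, 'b, 's) config \<Rightarrow> ('b, 's, 'r, 'x, 'v) event \<Rightarrow> bool" where
  "issued M c (k, Inv opn) \<longleftrightarrow> True"
| "issued M c (k, Resp res) \<longleftrightarrow> next_cmd M (proc_of k) (proc_state c (proc_of k)) = Return res"
| "issued M c (k, Prim b pr r) \<longleftrightarrow>
     next_cmd M (proc_of k) (proc_state c (proc_of k)) = Apply b pr \<and> r = snd pr (base_state c b)"

definition upd_proc :: "nat \<Rightarrow> ('l \<Rightarrow> 'l) \<Rightarrow> ('l, 'b, 's) config \<Rightarrow> ('l, 'b, 's) config" where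
  "upd_proc p u c = c\<lparr>proc_state := (proc_state c)(p := u (proc_state c p))\<rparr>"

fun after_event ::
  "('l, 'b, 's, 'r, 'x, 'v) tm \<Rightarrow> ('l, 'b, 's) config \<Rightarrow> ('b, 's, 'r, 'x, 'v) event
     \<Rightarrow> ('l, 'b, 's) config" where
  "after_event M c (k, Inv opn) = upd_proc (proc_of k) (on_inv M k opn) c"
| "after_event M c (k, Resp res) = upd_proc (proc_of k) (on_return M (proc_of k)) c"
| "after_event M c (k, Prim b pr r) =
     upd_proc (proc_of k) (on_prim M (proc_of k) r)
       (c\<lparr>base_state := (base_state c)(b := fst pr (base_state c b))\<rparr>)"

fun run_from ::
  "('l, 'b, 's, 'r, 'x, 'v) tm \<Rightarrow> ('l, 'b, 's) config \<Rightarrow> ('b, 's, 'r, 'x, 'v) exec \<Rightarrow> bool" where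
  "run_from M c [] \<longleftrightarrow> True"
| "run_from M c (e # E) \<longleftrightarrow> issued M c e \<and> run_from M (after_event M c e) E"

definition txns :: "('b, 's, 'r, 'x, 'v) exec \<Rightarrow> tid set" where
  "txns E = fst ` set E"

definition proj :: "('b, 's, 'r, 'x, 'v) exec \<Rightarrow> tid \<Rightarrow> ('b, 's, 'r, 'x, 'v) act list" where
  "proj E k = map snd (filter (\<lambda>e. fst e = k) E)"

definition committed :: "('b, 's, 'r, 'x, 'v) exec \<Rightarrow> tid \<Rightarrow> bool" where
  "committed E k \<longleftrightarrow> proj E k \<noteq> [] \<and> last (proj E k) = Resp Commit"

definition aborted :: "('b, 's, 'r, 'x, 'v) exec \<Rightarrow> tid \<Rightarrow> bool" where
  "aborted E k \<longleftrightarrow> proj E k \<noteq> [] \<and> last (proj E k) = Resp Abort"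

definition t_complete :: "('b, 's, 'r, 'x, 'v) exec \<Rightarrow> tid \<Rightarrow> bool" where
  "t_complete E k \<longleftrightarrow> committed E k \<or> aborted E k"

definition rt_prec :: "('b, 's, 'r, 'x, 'v) exec \<Rightarrow> tid \<Rightarrow> tid \<Rightarrow> bool" where
  "rt_prec E k m \<longleftrightarrow> k \<in> txns E \<and> m \<in> txns E \<and> t_complete E k \<and>
     (\<forall>i < length E. \<forall>j < length E. fst (E ! i) = k \<and> fst (E ! j) = m \<longrightarrow> i < j)"

text \<open>The first argument of \<open>wf_acts\<close> is the pending t-operation, if any.\<close>

fun wf_acts :: "('x, 'v) t_op option \<Rightarrow> ('b, 's, 'r, 'x, 'v) act list \<Rightarrow> bool" where
  "wf_acts pending [] \<longleftrightarrow> True"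
| "wf_acts None (Inv opn # as) \<longleftrightarrow> wf_acts (Some opn) as"
| "wf_acts None (Resp res # as) \<longleftrightarrow> False"
| "wf_acts None (Prim b pr r # as) \<longleftrightarrow> False"
| "wf_acts (Some opn) (Inv opn' # as) \<longleftrightarrow> False"
| "wf_acts (Some opn) (Resp res # as) \<longleftrightarrow>
     matching opn res \<and> (if res \<in> {Commit, Abort} then as = [] else wf_acts None as)"
| "wf_acts (Some opn) (Prim b pr r # as) \<longleftrightarrow> wf_acts (Some opn) as"

definition well_formed :: "('b, 's, 'r, 'x, 'v) exec \<Rightarrow> bool" where
  "well_formed E \<longleftrightarrow>
     (\<forall>k \<in> txns E. wf_acts None (proj E k)) \<and>
     (\<forall>k \<in> txns E. \<forall>m \<in> txns E. k \<noteq> m \<and> proc_of k = proc_of m \<longrightarrow> rt_prec E k m \<or> rt_prec E m k)"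

definition execution :: "('l, 'b, 's, 'r, 'x, 'v) tm \<Rightarrow> ('b, 's, 'r, 'x, 'v) exec \<Rightarrow> bool" where
  "execution M E \<longleftrightarrow>
     (\<forall>k \<in> txns E. proc_of k < nprocs M) \<and>
     (\<forall>k opn. (k, Inv opn) \<in> set E \<longrightarrow> op_objs opn \<subseteq> tobjs M) \<and>
     well_formed E \<and> run_from M (init_config M) E"


section \<open>Data sets, concurrency, contention\<close>

definition Rset :: "('b, 's, 'r, 'x, 'v) exec \<Rightarrow> tid \<Rightarrow> 'x set" where
  "Rset E k = {X. (k, Inv (Read X)) \<in> set E}"

definition Wset :: "('b, 's, 'r, 'x, 'v) exec \<Rightarrow> tid \<Rightarrow> 'x set" where
  "Wset E k = {X. \<exists>v. (k, Inv (Write X v)) \<in> set E}"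

definition Dset :: "('b, 's, 'r, 'x, 'v) exec \<Rightarrow> tid \<Rightarrow> 'x set" where
  "Dset E k = Rset E k \<union> Wset E k"

definition read_only :: "('b, 's, 'r, 'x, 'v) exec \<Rightarrow> tid \<Rightarrow> bool" where
  "read_only E k \<longleftrightarrow> Wset E k = {}"

definition concurrent :: "('b, 's, 'r, 'x, 'v) exec \<Rightarrow> tid \<Rightarrow> tid \<Rightarrow> bool" where
  "concurrent E k m \<longleftrightarrow> \<not> rt_prec E k m \<and> \<not> rt_prec E m k"

definition t_sequential :: "('b, 's, 'r, 'x, 'v) exec \<Rightarrow> bool" where
  "t_sequential E \<longleftrightarrow> (\<forall>k \<in> txns E. \<forall>m \<in> txns E. k \<noteq> m \<longrightarrow> \<not> concurrent E k m)"

definition contend :: "('b, 's, 'r, 'x, 'v) exec \<Rightarrow> tid \<Rightarrow> tid \<Rightarrow> 'b \<Rightarrow> bool" where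
  "contend E k m b \<longleftrightarrow>
     (\<exists>pr r pr' r'. (k, Prim b pr r) \<in> set E \<and> (m, Prim b pr' r') \<in> set E \<and>
        (nontrivial_prim pr \<or> nontrivial_prim pr'))"

definition step_contention_free :: "('b, 's, 'r, 'x, 'v) exec \<Rightarrow> tid \<Rightarrow> bool" where
  "step_contention_free E k \<longleftrightarrow>
     (\<exists>A B C. E = A @ B @ C \<and> txns B \<subseteq> {k} \<and> k \<notin> txns A \<and> k \<notin> txns C)"


section \<open>Opacity\<close>

definition history :: "('b, 's, 'r, 'x, 'v) exec \<Rightarrow> ('b, 's, 'r, 'x, 'v) exec" where
  "history E = filter (\<lambda>(k, a). case a of Prim b pr r \<Rightarrow> False | _ \<Rightarrow> True) E"

definition equivalent_hist ::
  "('b, 's, 'r, 'x, 'v) exec \<Rightarrow> ('b, 's, 'r, 'x, 'v) exec \<Rightarrow> bool" where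
  "equivalent_hist H H' \<longleftrightarrow> txns H = txns H' \<and> (\<forall>k \<in> txns H. proj H k = proj H' k)"

text \<open>The possible continuations of a transaction of a history in the completions of the history.\<close>

definition completion_tails :: "('b, 's, 'r, 'x, 'v) act list \<Rightarrow> ('b, 's, 'r, 'x, 'v) act list set" where
  "completion_tails as =
     (if as = [] then {[]}
      else case last as of
        Inv TryC \<Rightarrow> {[Resp Commit], [Resp Abort]}
      | Inv _ \<Rightarrow> {[Resp Abort]}
      | Resp res \<Rightarrow> (if res \<in> {Commit, Abort} then {[]} else {[Inv TryC, Resp Abort]})
      | Prim b pr r \<Rightarrow> {[]})"

definition completion ::
  "('b, 's, 'r, 'x, 'v) exec \<Rightarrow> ('b, 's, 'r, 'x, 'v) exec \<Rightarrow> bool" where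
  "completion H H' \<longleftrightarrow> subseq H H' \<and>
     (\<forall>k. \<exists>t \<in> completion_tails (proj H k). proj H' k = proj H k @ t)"

text \<open>
  The latest written value of \<open>X\<close> for a read by \<open>T\<^sub>k\<close> invoked at position \<open>i\<close> of \<open>S\<close>. The initial
  values \<open>ini\<close> are those written by the imaginary initial transaction.
\<close>

definition latest_written ::
  "('x \<Rightarrow> 'v) \<Rightarrow> ('b, 's, 'r, 'x, 'v) exec \<Rightarrow> nat \<Rightarrow> tid \<Rightarrow> 'x \<Rightarrow> 'v" where
  "latest_written ini S i k X =
     (let own = [v. (m, Inv (Write Y v)) \<leftarrow> take i S, m = k \<and> Y = X];
          others = [v. (m, Inv (Write Y v)) \<leftarrow> take i S, committed S m \<and> rt_prec S m k \<and> Y = X]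
      in if own \<noteq> [] then last own else last (ini X # others))"

text \<open>
  In a t-sequential history, the response of a t-operation immediately follows its invocation.
\<close>

definition legal :: "('x \<Rightarrow> 'v) \<Rightarrow> ('b, 's, 'r, 'x, 'v) exec \<Rightarrow> bool" where
  "legal ini S \<longleftrightarrow>
     (\<forall>i k X v. Suc i < length S \<and> S ! i = (k, Inv (Read X)) \<and> S ! Suc i = (k, Resp (Val v))
        \<longrightarrow> v = latest_written ini S i k X)"

definition opaque_hist :: "('x \<Rightarrow> 'v) \<Rightarrow> ('b, 's, 'r, 'x, 'v) exec \<Rightarrow> bool" where
  "opaque_hist ini H \<longleftrightarrow>
     (\<exists>S. t_sequential S \<and> (\<forall>k \<in> txns S. t_complete S k) \<and> legal ini S \<and>
        (\<forall>k \<in> txns H. \<forall>m \<in> txns H. rt_prec H k m \<longrightarrow> rt_prec S k m) \<and>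
        (\<exists>H'. completion H H' \<and> equivalent_hist S H'))"

definition opaque :: "('l, 'b, 's, 'r, 'x, 'v) tm \<Rightarrow> bool" where
  "opaque M \<longleftrightarrow> (\<forall>E. execution M E \<longrightarrow> opaque_hist (tobj_init M) (history E))"


section \<open>Obstruction-freedom and disjoint-access parallelism\<close>

text \<open>
  As \<open>M\<close> is deterministic, the step contention-free extension for the invoked t-operation is
  unique; \<open>F\<close> consists of its events before the response.
\<close>

definition OF_liveness :: "('l, 'b, 's, 'r, 'x, 'v) tm \<Rightarrow> bool" where
  "OF_liveness M \<longleftrightarrow>
     (\<forall>E k opn. execution M (E @ [(k, Inv opn)]) \<longrightarrow>
        (\<exists>F res. (\<forall>e \<in> set F. \<exists>b pr r. e = (k, Prim b pr r)) \<and>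
           execution M (E @ [(k, Inv opn)] @ F @ [(k, Resp res)])))"

definition OF_progress :: "('l, 'b, 's, 'r, 'x, 'v) tm \<Rightarrow> bool" where
  "OF_progress M \<longleftrightarrow>
     (\<forall>E k. execution M E \<and> (k, Resp Abort) \<in> set E \<longrightarrow> \<not> step_contention_free E k)"

definition tau :: "('b, 's, 'r, 'x, 'v) exec \<Rightarrow> tid \<Rightarrow> tid \<Rightarrow> tid set" where
  "tau E i j = {i, j} \<union> {k \<in> txns E. concurrent E k i \<or> concurrent E k j}"

definition conflict_edges :: "('b, 's, 'r, 'x, 'v) exec \<Rightarrow> tid \<Rightarrow> tid \<Rightarrow> ('x \<times> 'x) set" where
  "conflict_edges E i j = {(X, Y). \<exists>k \<in> tau E i j. {X, Y} \<subseteq> Wset E k}"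

definition rw_disjoint_access :: "('b, 's, 'r, 'x, 'v) exec \<Rightarrow> tid \<Rightarrow> tid \<Rightarrow> bool" where
  "rw_disjoint_access E i j \<longleftrightarrow>
     \<not> (\<exists>X \<in> Dset E i. \<exists>Y \<in> Dset E j. (X, Y) \<in> (conflict_edges E i j)\<^sup>*)"

definition RW_DAP :: "('l, 'b, 's, 'r, 'x, 'v) tm \<Rightarrow> bool" where
  "RW_DAP M \<longleftrightarrow>
     (\<forall>E. execution M E \<longrightarrow>
        (\<forall>i \<in> txns E. \<forall>j \<in> txns E. i \<noteq> j \<and> (\<exists>b. contend E i j b) \<longrightarrow>
           \<not> rw_disjoint_access E i j \<or> Dset E i \<inter> Dset E j \<noteq> {}))"


section \<open>RAW and AWAR patterns\<close>

definition writes_at :: "('b, 's, 'r, 'x, 'v) exec \<Rightarrow> tid \<Rightarrow> nat \<Rightarrow> 'b \<Rightarrow> bool" where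
  "writes_at E k i b \<longleftrightarrow>
     i < length E \<and> (\<exists>pr r. E ! i = (k, Prim b pr r) \<and> nontrivial_prim pr)"

definition reads_at :: "('b, 's, 'r, 'x, 'v) exec \<Rightarrow> tid \<Rightarrow> nat \<Rightarrow> 'b \<Rightarrow> bool" where
  "reads_at E k i b \<longleftrightarrow>
     i < length E \<and> (\<exists>pr r. E ! i = (k, Prim b pr r) \<and> reading_prim pr)"

definition RAW :: "('b, 's, 'r, 'x, 'v) exec \<Rightarrow> tid \<Rightarrow> nat \<Rightarrow> nat \<Rightarrow> bool" where
  "RAW E k i j \<longleftrightarrow> i < j \<and>
     (\<exists>b b'. b' \<noteq> b \<and> writes_at E k i b \<and> reads_at E k j b' \<and>
        (\<forall>l. i < l \<and> l < j \<longrightarrow> \<not> writes_at E k l b'))"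

definition AWAR :: "('b, 's, 'r, 'x, 'v) exec \<Rightarrow> tid \<Rightarrow> nat \<Rightarrow> bool" where
  "AWAR E k i \<longleftrightarrow> (\<exists>b. writes_at E k i b \<and> reads_at E k i b)"

text \<open>
  A pair \<open>(i, j)\<close> stands for a RAW with its write at position \<open>i\<close> and its read at position \<open>j\<close>;
  a pair \<open>(i, i)\<close> stands for an AWAR at position \<open>i\<close>. An AWAR inside a RAW overlaps it, so that
  no event is counted twice.
\<close>

definition non_overlapping :: "nat \<times> nat \<Rightarrow> nat \<times> nat \<Rightarrow> bool" where
  "non_overlapping P Q \<longleftrightarrow> snd P < fst Q \<or> snd Q < fst P"

definition performs_RAW_AWARs :: "('b, 's, 'r, 'x, 'v) exec \<Rightarrow> tid \<Rightarrow> nat \<Rightarrow> bool" where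
  "performs_RAW_AWARs E k N \<longleftrightarrow>
     (\<exists>R. finite R \<and> card R = N \<and>
        (\<forall>(i, j) \<in> R. RAW E k i j \<or> (i = j \<and> AWAR E k i)) \<and>
        pairwise non_overlapping R)"

end

theory Submission
  imports Defs
begin

text \<open>
  For each \<open>j\<close>, an updater reads \<open>Z\<^sub>j\<close>, writes \<open>X\<^sub>j\<close>, and is stopped during its \<open>tryC\<close> just before
  the critical step \<open>e\<^sub>j\<close> after which an observer running alone would first read the new value of
  \<open>X\<^sub>j\<close>. Then an overwriter of \<open>Z\<^sub>j\<close> runs alone and commits. Finally the reader reads
  \<open>X\<^sub>0, X\<^sub>1, \<dots>\<close>. The updater has read the old value of \<open>Z\<^sub>j\<close>, so it can only be serialized before
  the overwriter, hence before the reader and the observer, and these two must agree on whether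
  \<open>X\<^sub>j\<close> is new.

  If the read of \<open>X\<^sub>j\<close> by the reader had no RAW and no AWAR, then, from its first write on, it would
  read only what it has just written itself. So all steps inserted right before this first write go
  unnoticed. Insert a read of \<open>X\<^sub>j\<close> by the observer if the reader returns the new value, and \<open>e\<^sub>j\<close>
  followed by such a read otherwise. By disjoint-access parallelism the observer returns the
  same value as it does right after the steps of the updater; so the two reads disagree.
\<close>

declare split_paired_All [simp del] split_paired_Ex [simp del]

section \<open>Runs and configurations\<close>

abbreviation after :: "('l, 'b, 's, 'r, 'x, 'v) tm \<Rightarrow> ('l, 'b, 's) config \<Rightarrow>
    ('b, 's, 'r, 'x, 'v) exec \<Rightarrow> ('l, 'b, 's) config" where
  "after M \<equiv> foldl (after_event M)"

abbreviation conf :: "('l, 'b, 's, 'r, 'x, 'v) tm \<Rightarrow> ('b, 's, 'r, 'x, 'v) exec \<Rightarrow>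
    ('l, 'b, 's) config" where
  "conf M \<equiv> after M (init_config M)"

definition accessed :: "('b, 's, 'r, 'x, 'v) exec \<Rightarrow> 'b set" where
  "accessed E = {b. \<exists>k pr r. (k, Prim b pr r) \<in> set E}"

definition procs :: "('b, 's, 'r, 'x, 'v) exec \<Rightarrow> nat set" where
  "procs E = proc_of ` txns E"

definition trivial_on :: "('b, 's, 'r, 'x, 'v) exec \<Rightarrow> 'b \<Rightarrow> bool" where
  "trivial_on E b \<longleftrightarrow> (\<forall>k pr r. (k, Prim b pr r) \<in> set E \<longrightarrow> trivial_prim pr)"

text \<open>Indistinguishability: processes in \<open>P\<close> that access only base objects in
  \<open>B\<close> behave alike in both configurations.\<close>

definition agree :: "nat set \<Rightarrow> 'b set \<Rightarrow> ('l, 'b, 's) config \<Rightarrow> ('l, 'b, 's) config \<Rightarrow> bool" where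
  "agree P B c c' \<longleftrightarrow> (\<forall>p\<in>P. proc_state c p = proc_state c' p) \<and>
     (\<forall>b\<in>B. base_state c b = base_state c' b)"

lemma accessed_simps [simp]:
  "accessed [] = {}"
  "accessed (E @ F) = accessed E \<union> accessed F"
  "accessed ((k, Inv opn) # E) = accessed E"
  "accessed ((k, Resp res) # E) = accessed E"
  "accessed ((k, Prim b pr r) # E) = insert b (accessed E)"
  unfolding accessed_def by (simp_all, blast+)

lemma txns_simps [simp]:
  "txns [] = {}" "txns (E @ F) = txns E \<union> txns F" "txns (e # E) = insert (fst e) (txns E)"
  by (auto simp: txns_def)

lemma procs_simps [simp]:
  "procs [] = {}" "procs (E @ F) = procs E \<union> procs F"
  "procs (e # E) = insert (proc_of (fst e)) (procs E)"
  by (auto simp: procs_def)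

lemma run_from_append [simp]:
  "run_from M c (E @ F) \<longleftrightarrow> run_from M c E \<and> run_from M (after M c E) F"
  by (induction E arbitrary: c) auto

lemma agree_step:
  assumes "agree P B c c'" "proc_of (fst e) \<in> P" "accessed [e] \<subseteq> B"
  shows "issued M c e = issued M c' e" "agree P B (after_event M c e) (after_event M c' e)"
proof -
  obtain k a where e: "e = (k, a)" by (cases e)
  show "issued M c e = issued M c' e"
    using assms unfolding e by (cases a) (auto simp: agree_def)
  show "agree P B (after_event M c e) (after_event M c' e)"
    using assms unfolding e by (cases a) (auto simp: agree_def upd_proc_def)
qed

text \<open>What a process issues depends only on its local state and on the base objects that it
  accesses, and each event preserves the agreement.\<close>

lemma agree_run:
  assumes "run_from M c D" "agree P B c c'" "procs D \<subseteq> P" "accessed D \<subseteq> B"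
  shows "run_from M c' D"
  using assms
proof (induction D arbitrary: c c')
  case (Cons e D)
  have "accessed [e] \<union> accessed D = accessed (e # D)"
    by (metis accessed_simps(2) append_Cons append_Nil)
  with Cons.prems have e: "proc_of (fst e) \<in> P" "accessed [e] \<subseteq> B" "accessed D \<subseteq> B"
    by auto
  from agree_step[OF Cons.prems(2) e(1,2)] Cons.IH Cons.prems e(3) show ?case by auto
qed simp

lemma proc_state_after_event:
  "p \<noteq> proc_of (fst e) \<Longrightarrow> proc_state (after_event M c e) p = proc_state c p"
  by (cases e; cases "snd e") (auto simp: upd_proc_def)

lemma proc_state_after:
  "p \<notin> procs D \<Longrightarrow> proc_state (after M c D) p = proc_state c p"
  by (induction D arbitrary: c) (auto simp: proc_state_after_event)

lemma base_state_after:
  assumes "trivial_on D b"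
  shows "base_state (after M c D) b = base_state c b"
  using assms
proof (induction D arbitrary: c)
  case (Cons e D)
  have "base_state (after_event M c e) b = base_state c b"
    using Cons.prems
    by (cases e; cases "snd e") (auto simp: upd_proc_def trivial_on_def trivial_prim_def)
  moreover have "trivial_on D b" using Cons.prems unfolding trivial_on_def by (metis list.set_intros(2))
  ultimately show ?case using Cons.IH by simp
qed simp

lemma agree_after:
  assumes "P \<inter> procs D = {}" "\<And>b. b \<in> B \<Longrightarrow> trivial_on D b"
  shows "agree P B c (after M c D)"
  unfolding agree_def using assms proc_state_after base_state_after by (metis disjoint_iff)

lemma agree_sym: "agree P B c c' \<Longrightarrow> agree P B c' c"
  by (auto simp: agree_def)

lemma agree_mono: "agree P B c c' \<Longrightarrow> P' \<subseteq> P \<Longrightarrow> B' \<subseteq> B \<Longrightarrow> agree P' B' c c'"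
  by (auto simp: agree_def)

section \<open>Runs of a single t-operation\<close>

definition prims_of :: "tid \<Rightarrow> ('b, 's, 'r, 'x, 'v) exec \<Rightarrow> bool" where
  "prims_of k F \<longleftrightarrow> (\<forall>e\<in>set F. \<exists>b pr r. e = (k, Prim b pr r))"

abbreviation op_run :: "tid \<Rightarrow> ('x, 'v) t_op \<Rightarrow> ('b, 's, 'r, 'x, 'v) exec \<Rightarrow> 'v t_res \<Rightarrow>
    ('b, 's, 'r, 'x, 'v) exec" where
  "op_run k opn F res \<equiv> (k, Inv opn) # F @ [(k, Resp res)]"

lemma prims_of_simps [simp]:
  "prims_of k []" "prims_of k (E @ F) \<longleftrightarrow> prims_of k E \<and> prims_of k F"
  "prims_of k (e # F) \<longleftrightarrow> (\<exists>b pr r. e = (k, Prim b pr r)) \<and> prims_of k F"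
  by (simp_all add: prims_of_def ball_Un)

lemma prims_of_txns: "prims_of k F \<Longrightarrow> txns F \<subseteq> {k}"
  by (auto simp: prims_of_def txns_def)

lemma prims_of_resp: "prims_of k F \<Longrightarrow> (k', Resp res) \<notin> set F"
  and prims_of_inv: "prims_of k F \<Longrightarrow> (k', Inv opn) \<notin> set F"
  by (auto simp: prims_of_def)

text \<open>The configuration fixes the next command and its response. As a \<open>Return\<close> is
  never an \<open>Apply\<close>, neither operation can end before the other.\<close>

lemma run_deterministic:
  assumes "run_from M c (F @ [(k, Resp res)])" "run_from M c (F' @ [(k, Resp res')])"
    "prims_of k F" "prims_of k F'"
  shows "F = F' \<and> res = res'"
  using assms
proof (induction F arbitrary: c F')
  case Nil
  then show ?case by (cases F') auto
next
  case (Cons e F)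
  from Cons.prems(3) obtain b pr r where e: "e = (k, Prim b pr r)" by auto
  with Cons.prems(1) have cmd: "next_cmd M (proc_of k) (proc_state c (proc_of k)) = Apply b pr"
    "r = snd pr (base_state c b)" by auto
  with Cons.prems(2) obtain e' G where F': "F' = e' # G" by (cases F') auto
  with Cons.prems(4) obtain b' pr' r' where e': "e' = (k, Prim b' pr' r')" by auto
  with Cons.prems(2) F' cmd have "e' = e" by (auto simp: e)
  with Cons.IH[of "after_event M c e" G] Cons.prems F' show ?case by auto
qed

lemma op_run_deterministic:
  assumes "run_from M c (op_run k opn F res)" "run_from M c (op_run k opn F' res')"
    "prims_of k F" "prims_of k F'"
  shows "F = F'" "res = res'"
  using run_deterministic[of M "after_event M c (k, Inv opn)" F k res F' res'] assms by auto

section \<open>Projections and well-formedness\<close>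

lemma proj_simps [simp]:
  "proj [] k = []" "proj (E @ F) k = proj E k @ proj F k"
  "proj (e # E) k = (if fst e = k then snd e # proj E k else proj E k)"
  by (auto simp: proj_def)

lemma set_proj [simp]: "a \<in> set (proj E k) \<longleftrightarrow> (k, a) \<in> set E"
  by (force simp: proj_def)

lemma proj_eq_Nil_iff [simp]: "proj E k = [] \<longleftrightarrow> k \<notin> txns E"
  by (auto simp: proj_def txns_def filter_empty_conv)

lemma proj_notin_txns [simp]: "k \<notin> txns E \<Longrightarrow> proj E k = []"
  using proj_eq_Nil_iff by blast

lemma history_simps [simp]:
  "history [] = []" "history (E @ F) = history E @ history F"
  "history ((k, Inv opn) # E) = (k, Inv opn) # history E"
  "history ((k, Resp res) # E) = (k, Resp res) # history E"
  "history ((k, Prim b pr r) # E) = history E"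
  by (auto simp: history_def)

lemma history_prims [simp]: "prims_of k F \<Longrightarrow> history F = []"
  by (induction F) auto

lemma in_history:
  "(k, Inv opn) \<in> set (history E) \<longleftrightarrow> (k, Inv opn) \<in> set E"
  "(k, Resp res) \<in> set (history E) \<longleftrightarrow> (k, Resp res) \<in> set E"
  by (auto simp: history_def)

lemma last_proj_history:
  assumes "proj E k \<noteq> []" "last (proj E k) = Resp res"
  shows "proj (history E) k \<noteq> [] \<and> last (proj (history E) k) = Resp res"
  using assms
proof (induction E rule: rev_induct)
  case (snoc e E)
  obtain k' a where e: "e = (k', a)" by (cases e)
  show ?case using snoc unfolding e by (cases a) (auto split: if_splits)
qed simp

lemma t_complete_history: "t_complete E k \<Longrightarrow> t_complete (history E) k"
  and committed_history: "committed E k \<Longrightarrow> committed (history E) k"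
  unfolding t_complete_def committed_def aborted_def using last_proj_history by blast+

text \<open>Positions shift when executions are concatenated or filtered, whereas
  \<open>sorted_wrt\<close> is compatible with both. This form therefore serves for extensions and
  for histories.\<close>

lemma rt_prec_iff:
  "rt_prec E k m \<longleftrightarrow> k \<in> txns E \<and> m \<in> txns E \<and> t_complete E k \<and> k \<noteq> m \<and>
     sorted_wrt (\<lambda>e e'. \<not> (fst e = m \<and> fst e' = k)) E" (is "?L \<longleftrightarrow> ?R")
proof
  assume L: ?L
  then obtain i where "i < length E" "fst (E ! i) = k"
    by (auto simp: rt_prec_def txns_def in_set_conv_nth)
  with L have "k \<noteq> m" unfolding rt_prec_def by blast
  moreover have "\<not> (fst (E ! i) = m \<and> fst (E ! j) = k)" if "i < j" "j < length E" for i j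
  proof
    assume "fst (E ! i) = m \<and> fst (E ! j) = k"
    with L that have "j < i" unfolding rt_prec_def using less_trans by blast
    with that(1) show False by simp
  qed
  ultimately show ?R using L unfolding rt_prec_def sorted_wrt_iff_nth_less by blast
next
  assume R: ?R
  have "i < j" if "i < length E" "j < length E" "fst (E ! i) = k" "fst (E ! j) = m" for i j
  proof (rule ccontr)
    assume "\<not> i < j"
    with R that have "j < i" by (metis linorder_neqE_nat)
    with R that show False unfolding sorted_wrt_iff_nth_less by blast
  qed
  then show ?L using R unfolding rt_prec_def by blast
qed

lemma rt_prec_less:
  "rt_prec E k m \<Longrightarrow> i < length E \<Longrightarrow> j < length E \<Longrightarrow> fst (E ! i) = k \<Longrightarrow> fst (E ! j) = m \<Longrightarrow> i < j"
  unfolding rt_prec_def by blast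

lemma rt_prec_trans:
  assumes ab: "rt_prec E a b" and bc: "rt_prec E b c"
  shows "rt_prec E a c"
proof -
  have "b \<in> txns E" using ab unfolding rt_prec_def by blast
  then obtain j where j: "j < length E" "fst (E ! j) = b"
    by (metis txns_def image_iff in_set_conv_nth)
  have "i < l" if "i < length E" "l < length E" "fst (E ! i) = a" "fst (E ! l) = c" for i l
    using rt_prec_less[OF ab that(1) j(1) that(3) j(2)] rt_prec_less[OF bc j(1) that(2) j(2) that(4)]
    by (rule less_trans)
  moreover have "a \<in> txns E" "t_complete E a" "c \<in> txns E"
    using ab bc unfolding rt_prec_def by blast+
  ultimately show ?thesis unfolding rt_prec_def by (intro conjI allI impI) simp_all
qed

lemma rt_prec_appendI:
  assumes "k \<notin> txns F" "m \<notin> txns E" "t_complete E k" "m \<in> txns F"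
  shows "rt_prec (E @ F) k m"
proof -
  have k: "k \<in> txns E" using assms(3) by (auto simp: t_complete_def committed_def aborted_def)
  moreover have "t_complete (E @ F) k"
    using assms(1,3) proj_eq_Nil_iff[of F k]
    by (simp add: t_complete_def committed_def aborted_def)
  moreover have "sorted_wrt (\<lambda>e e'. \<not> (fst e = m \<and> fst e' = k)) (E @ F)"
  proof -
    have ne: "fst e \<noteq> m" "fst e' \<noteq> k" if "e \<in> set E" "e' \<in> set F" for e e'
      using assms(1,2) that by (auto simp: txns_def)
    then have "sorted_wrt (\<lambda>e e'. \<not> (fst e = m \<and> fst e' = k)) E"
      "sorted_wrt (\<lambda>e e'. \<not> (fst e = m \<and> fst e' = k)) F"
      using assms(1,2) unfolding txns_def
      by (auto intro!: sorted_wrt_mono_rel[of _ "\<lambda>_ _. True"] simp: sorted_wrt_iff_nth_less)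
    with ne show ?thesis unfolding sorted_wrt_append by blast
  qed
  ultimately show ?thesis using assms by (auto simp: rt_prec_iff)
qed

text \<open>Through this, conditions on invocations constrain every transaction, and no transaction
  is lost in the history.\<close>

lemma first_event_inv:
  assumes "wf_acts None (proj E k)" "k \<in> txns E"
  obtains opn where "(k, Inv opn) \<in> set E"
proof -
  obtain a as where p: "proj E k = a # as" using assms(2) by (cases "proj E k") auto
  with assms(1) obtain opn where "a = Inv opn" by (cases a) auto
  with p have "Inv opn \<in> set (proj E k)" by simp
  with that show thesis by simp
qed

lemma rt_prec_history:
  assumes "well_formed E" "rt_prec E k m"
  shows "rt_prec (history E) k m"
proof -
  have "k' \<in> txns (history E)" if "k' \<in> txns E" for k'
  proof -
    have "wf_acts None (proj E k')" using assms(1) that by (simp add: well_formed_def)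
    from first_event_inv[OF this that] show ?thesis
      using in_history(1) unfolding txns_def by (metis fst_conv image_eqI)
  qed
  moreover have "sorted_wrt (\<lambda>e e'. \<not> (fst e = m \<and> fst e' = k)) (history E)"
    using assms(2) unfolding rt_prec_iff history_def by (auto intro: sorted_wrt_filter)
  ultimately show ?thesis using assms(2) t_complete_history unfolding rt_prec_iff by blast
qed

text \<open>A response other than commit and abort leaves no operation pending, so the check
  restarts with \<open>None\<close>.\<close>

lemma wf_acts_append:
  assumes "wf_acts p as" "as \<noteq> []" "last as = Resp res" "res \<notin> {Commit, Abort}"
  shows "wf_acts p (as @ bs) \<longleftrightarrow> wf_acts None bs"
  using assms
proof (induction p as rule: wf_acts.induct)
  case (6 opn res as)
  then show ?case by (cases "as = []") (auto split: if_splits)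
qed (auto split: if_splits)

lemma wf_acts_prefix: "wf_acts p (as @ bs) \<Longrightarrow> wf_acts p as"
  by (induction p as rule: wf_acts.induct) (auto split: if_splits)

text \<open>\<open>OF_liveness\<close> leaves open which response is returned; well-formedness of
  the extended execution forces it to match.\<close>

lemma wf_acts_matching:
  assumes "wf_acts p (as @ Inv opn # ps @ Resp res # bs)" "\<And>a. a \<in> set ps \<Longrightarrow> \<exists>b pr r. a = Prim b pr r"
  shows "matching opn res"
  using assms
proof (induction p as rule: wf_acts.induct)
  case (1 p)
  have "wf_acts (Some opn) (ps @ Resp res # bs) \<Longrightarrow> matching opn res"
    using 1(2)
  proof (induction ps)
    case (Cons a ps)
    from Cons.prems(2)[of a] obtain b pr r where "a = Prim b pr r" by auto
    with Cons show ?case by auto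
  qed (auto split: if_splits)
  with 1 show ?case by (cases p) auto
qed (auto split: if_splits)

section \<open>Opacity\<close>

text \<open>Formulated on the history projected to \<open>k\<close>, so that neither steps of other
  transactions nor primitives inside the read matter.\<close>

definition reads_in :: "('b, 's, 'r, 'x, 'v) exec \<Rightarrow> tid \<Rightarrow> 'x \<Rightarrow> 'v \<Rightarrow> bool" where
  "reads_in E k x v \<longleftrightarrow>
     (\<exists>as bs. proj (history E) k = as @ Inv (Read x) # Resp (Val v) # bs)"

lemma reads_in_op_run:
  assumes "prims_of k F"
  shows "reads_in (A @ op_run k (Read x) F (Val v) @ B) k x v"
  unfolding reads_in_def using assms by auto

lemma reads_in_append: "reads_in E k x v \<Longrightarrow> reads_in (E @ F) k x v"
  unfolding reads_in_def by (metis append.assoc append_Cons history_simps(2) proj_simps(2))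

lemma reads_in_cong: "proj (history E) k = proj (history E') k \<Longrightarrow> reads_in E k x v = reads_in E' k x v"
  by (simp add: reads_in_def)

text \<open>Projecting to a transaction commutes with dropping the primitives.\<close>

lemma proj_history_cong: "proj E k = proj E' k \<Longrightarrow> proj (history E) k = proj (history E') k"
proof -
  have "proj (history E) k = filter (\<lambda>a. case a of Prim b pr r \<Rightarrow> False | _ \<Rightarrow> True) (proj E k)" for E :: "('a, 'b, 'c, 'd, 'e) exec"
    by (auto simp: history_def proj_def filter_map o_def conj_commute case_prod_unfold intro!: arg_cong[of _ _ "map snd"] filter_cong)
  then show "proj E k = proj E' k \<Longrightarrow> ?thesis" by simp
qed

lemma filter_eq_appendD:
  assumes "filter P xs = ys @ zs"
  shows "\<exists>us vs. xs = us @ vs \<and> filter P us = ys \<and> filter P vs = zs"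
  using assms
proof (induction xs arbitrary: ys)
  case (Cons x xs)
  show ?case
  proof (cases "P x \<and> ys = []")
    case True
    with Cons.prems show ?thesis by (intro exI[of _ "[]"] exI[of _ "x # xs"]) simp
  next
    case False
    then have "filter P xs = (if P x then tl ys else ys) @ zs"
      "P x \<Longrightarrow> ys = x # tl ys"
      using Cons.prems by (cases ys; auto split: if_splits)+
    with Cons.IH obtain us vs where "xs = us @ vs" "filter P us = (if P x then tl ys else ys)"
      "filter P vs = zs" by blast
    with \<open>P x \<Longrightarrow> ys = x # tl ys\<close> show ?thesis
      by (intro exI[of _ "x # us"] exI[of _ vs]) auto
  qed
qed simp

text \<open>An event of another transaction between the two would come after one event of
  \<open>k\<close> and before another, against real-time order in either direction. This links
  \<open>legal\<close>, which speaks of adjacent positions of \<open>S\<close>, to reads found in a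
  projection.\<close>

lemma proj_consecutive:
  assumes "proj S k = as @ a # b # bs" "t_sequential S"
  obtains i where "Suc i < length S" "S ! i = (k, a)" "S ! Suc i = (k, b)"
proof -
  from assms(1) obtain E1 e1 e2 E2 where f: "filter (\<lambda>e. fst e = k) S = E1 @ e1 # e2 # E2"
    "snd e1 = a" "snd e2 = b"
    unfolding proj_def by (auto simp: map_eq_append_conv map_eq_Cons_conv)
  from filter_eq_appendD[OF f(1)] obtain S1 R where
    S: "S = S1 @ R" "filter (\<lambda>e. fst e = k) R = e1 # e2 # E2" by blast
  from filter_eq_ConsD[OF S(2)] obtain S2 R2 where
    R: "R = S2 @ e1 # R2" "fst e1 = k" "filter (\<lambda>e. fst e = k) R2 = e2 # E2" by metis
  from filter_eq_ConsD[OF R(3)] obtain S3 R3 where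
    R2: "R2 = S3 @ e2 # R3" "fst e2 = k" "\<forall>e\<in>set S3. fst e \<noteq> k" by metis
  have "S3 = []"
  proof (rule ccontr)
    assume "S3 \<noteq> []"
    then obtain e T where T: "S3 = e # T" by (cases S3) auto
    let ?m = "fst e"
    have all: "S = S1 @ S2 @ e1 # e # T @ e2 # R3" using S R R2 T by simp
    have "?m \<noteq> k" "?m \<in> txns S" "k \<in> txns S" using R2 T all R by auto
    with assms(2) have "rt_prec S k ?m \<or> rt_prec S ?m k"
      by (auto simp: t_sequential_def concurrent_def)
    then show False
      using R(2) R2(2) unfolding rt_prec_iff all by (auto simp: sorted_wrt_append)
  qed
  with S R R2 have "S = (S1 @ S2) @ e1 # e2 # R3" by simp
  moreover have "e1 = (k, a)" "e2 = (k, b)" using f R R2 by (auto simp: prod_eq_iff)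
  ultimately show thesis
    by (intro that[of "length (S1 @ S2)"]) (auto simp: nth_append)
qed

text \<open>The consequences of opacity used below, phrased for the execution instead of its
  history. \<open>TryC\<close> is excepted from the third clause because a completion may add it;
  the fifth clause says that a completion commits only transactions that have asked for it or have
  already committed.\<close>

definition serialization ::
  "('l, 'b, 's, 'r, 'x, 'v) tm \<Rightarrow> ('b, 's, 'r, 'x, 'v) exec \<Rightarrow> ('b, 's, 'r, 'x, 'v) exec \<Rightarrow> bool" where
  "serialization M E S \<longleftrightarrow> t_sequential S \<and>
     (\<forall>k m. rt_prec E k m \<longrightarrow> rt_prec S k m) \<and>
     (\<forall>k opn. opn \<noteq> TryC \<longrightarrow> ((k, Inv opn) \<in> set S \<longleftrightarrow> (k, Inv opn) \<in> set E)) \<and>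
     (\<forall>k. committed E k \<longrightarrow> committed S k) \<and>
     (\<forall>k. committed S k \<longrightarrow> (k, Inv TryC) \<in> set E \<or> (k, Resp Commit) \<in> set E) \<and>
     (\<forall>k x v. reads_in E k x v \<longrightarrow>
        (\<exists>i < length S. fst (S ! i) = k \<and> v = latest_written (tobj_init M) S i k x))"

lemma serializationD:
  assumes "serialization M E S"
  shows "t_sequential S"
    and "rt_prec E k m \<Longrightarrow> rt_prec S k m"
    and "opn \<noteq> TryC \<Longrightarrow> (k, Inv opn) \<in> set S \<longleftrightarrow> (k, Inv opn) \<in> set E"
    and "committed E k \<Longrightarrow> committed S k"
    and "committed S k \<Longrightarrow> (k, Inv TryC) \<in> set E \<or> (k, Resp Commit) \<in> set E"
    and "reads_in E k x v \<Longrightarrow>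
      \<exists>i < length S. fst (S ! i) = k \<and> v = latest_written (tobj_init M) S i k x"
  using assms unfolding serialization_def by blast+

lemma opaque_serialization:
  fixes M :: "('l, 'b, 's, 'r, 'x, 'v) tm"
  assumes "opaque M" "execution M E"
  shows "\<exists>S. serialization M E S"
proof -
  let ?H = "history E"
  from assms obtain S H' where S: "t_sequential S" "legal (tobj_init M) S"
    "\<And>k m. k \<in> txns ?H \<Longrightarrow> m \<in> txns ?H \<Longrightarrow> rt_prec ?H k m \<Longrightarrow> rt_prec S k m"
    "completion ?H H'" "equivalent_hist S H'"
    unfolding opaque_def opaque_hist_def by metis
  have "proj S k = proj H' k" for k
    using S(5) unfolding equivalent_hist_def by (metis proj_eq_Nil_iff)
  with S(4) have pr: "\<exists>t\<in>completion_tails (proj ?H k). proj S k = proj ?H k @ t" for k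
    unfolding completion_def by metis
  have wf: "well_formed E" using assms(2) by (simp add: execution_def)
  have "serialization M E S"
    unfolding serialization_def
  proof (intro conjI allI impI S(1))
    fix k m assume "rt_prec E k m"
    from rt_prec_history[OF wf this] have "rt_prec ?H k m" .
    moreover from this have "k \<in> txns ?H" "m \<in> txns ?H" unfolding rt_prec_iff by blast+
    ultimately show "rt_prec S k m" using S(3) by blast
  next
    fix k and opn :: "('x, 'v) t_op" assume o: "opn \<noteq> TryC"
    from pr[of k] obtain t where t: "t \<in> completion_tails (proj ?H k)" "proj S k = proj ?H k @ t"
      by blast
    \<comment> \<open>Completions add only responses and \<open>TryC\<close>.\<close>
    have "Inv opn \<notin> set t"
      using t(1) o by (auto simp: completion_tails_def split: if_splits act.splits t_op.splits)
    then have "Inv opn \<in> set (proj S k) \<longleftrightarrow> Inv opn \<in> set (proj ?H k)" using t by auto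
    then show "(k, Inv opn) \<in> set S \<longleftrightarrow> (k, Inv opn) \<in> set E" by (simp add: in_history)
  next
    fix k assume "committed E k"
    then have "committed ?H k" by (rule committed_history)
    then show "committed S k"
      using pr[of k] by (auto simp: committed_def completion_tails_def)
  next
    fix k assume c: "committed S k"
    from pr[of k] obtain t where t: "t \<in> completion_tails (proj ?H k)" "proj S k = proj ?H k @ t"
      by blast
    \<comment> \<open>A transaction committed in \<open>S\<close> ends with \<open>Commit\<close>,
      so its tail is either empty or the answer to a pending \<open>TryC\<close>.\<close>
    have lst: "a \<in> set (proj ?H k)" if "proj ?H k \<noteq> []" "last (proj ?H k) = a" for a
      using last_in_set that by blast
    from lst[of "Inv TryC"] lst[of "Resp Commit"] c t have "Inv TryC \<in> set (proj ?H k) \<or> Resp Commit \<in> set (proj ?H k)"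
      unfolding committed_def
      by (auto simp: completion_tails_def simp del: proj_eq_Nil_iff set_proj
          split: if_splits act.splits t_op.splits)
    then show "(k, Inv TryC) \<in> set E \<or> (k, Resp Commit) \<in> set E" by (simp add: in_history)
  next
    fix k x v assume "reads_in E k x v"
    with pr[of k] obtain as bs where "proj S k = as @ Inv (Read x) # Resp (Val v) # bs"
      unfolding reads_in_def by auto
    from proj_consecutive[OF this S(1)] obtain i where
      "Suc i < length S" "S ! i = (k, Inv (Read x))" "S ! Suc i = (k, Resp (Val v))" by blast
    with S(2) show "\<exists>i < length S. fst (S ! i) = k \<and> v = latest_written (tobj_init M) S i k x"
      unfolding legal_def by (metis Suc_lessD fst_conv)
  qed
  then show ?thesis ..
qed

text \<open>The reader has no write of its own to \<open>x\<close>, so the only alternative to the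
  initial value is the one written by \<open>j\<close>. If \<open>j\<close> precedes
  \<open>k\<close> in real time, its write stands before position \<open>i\<close>, which belongs to
  \<open>k\<close>, and is therefore seen.\<close>

lemma latest_written_single_writer:
  fixes S :: "('b, 's, 'r, 'x, 'v) exec"
  assumes w: "\<And>k v. (k, Inv (Write x v)) \<in> set S \<Longrightarrow> k = j \<and> v = nx"
    and "nx \<noteq> ini x" "k \<noteq> j" "i < length S" "fst (S ! i) = k"
  shows "latest_written ini S i k x = nx \<longleftrightarrow>
    committed S j \<and> rt_prec S j k \<and> (j, Inv (Write x nx)) \<in> set S"
proof -
  let ?own = "[v. (m, Inv (Write Y v)) \<leftarrow> take i S, m = k \<and> Y = x]"
  let ?oth = "[v. (m, Inv (Write Y v)) \<leftarrow> take i S, committed S m \<and> rt_prec S m k \<and> Y = x]"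
  \<comment> \<open>Stated for an arbitrary filter \<open>P\<close>, to cover both list
    comprehensions.\<close>
  have written: "set [v. (m, Inv (Write Y v)) \<leftarrow> T, P m Y] =
      {v. \<exists>m Y. (m, Inv (Write Y v)) \<in> set T \<and> P m Y}" for T :: "('b, 's, 'r, 'x, 'v) exec" and P
  proof (induction T)
    case (Cons e T)
    obtain m a where e: "e = (m, a)" by (cases e)
    show ?case
    proof (cases "\<exists>Y v. a = Inv (Write Y v)")
      case True
      then obtain Y v where "a = Inv (Write Y v)" by blast
      with Cons e show ?thesis by (simp, blast)
    next
      case False
      then have "(case e of (m, Inv (Write Y v)) \<Rightarrow> if P m Y then [v] else [] | _ \<Rightarrow> []) = []"
        unfolding e by (auto split: act.split t_op.split)
      moreover have "(m', Inv (Write Y v)) \<in> set (e # T) \<longleftrightarrow> (m', Inv (Write Y v)) \<in> set T" for m' Y v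
        using False e by auto
      ultimately show ?thesis using Cons by simp
    qed
  qed simp
  have "set ?own = {}"
    unfolding written using w assms(3) in_set_takeD by fast
  then have own: "?own = []" by (simp only: set_empty)
  have oth: "set ?oth = {v. \<exists>m. (m, Inv (Write x v)) \<in> set (take i S) \<and> committed S m \<and> rt_prec S m k}"
    unfolding written by blast
  have lw: "latest_written ini S i k x = last (ini x # ?oth)"
    unfolding latest_written_def Let_def using own by (simp only: simp_thms if_False)
  have all: "v = nx \<and> committed S j \<and> rt_prec S j k \<and> (j, Inv (Write x nx)) \<in> set S" if "v \<in> set ?oth" for v
    using that w in_set_takeD unfolding oth by fast
  show ?thesis
  proof (cases "?oth = []")
    case True
    have False if "committed S j" "rt_prec S j k" "(j, Inv (Write x nx)) \<in> set S"
    proof -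
      from that(3) obtain l where l: "l < length S" "S ! l = (j, Inv (Write x nx))"
        by (auto simp: in_set_conv_nth)
      with rt_prec_less[OF that(2) l(1) assms(4) _ assms(5)] have "l < i" by simp
      with l have "(j, Inv (Write x nx)) \<in> set (take i S)" by (auto simp: in_set_conv_nth)
      with that have "nx \<in> set ?oth" unfolding oth by blast
      then show False unfolding True by simp
    qed
    moreover have "latest_written ini S i k x = ini x"
      unfolding lw True by simp
    ultimately show ?thesis using assms(2) by argo
  next
    case False
    then have "last ?oth \<in> set ?oth" by (rule last_in_set)
    moreover have "latest_written ini S i k x = last ?oth"
      unfolding lw by (rule last_ConsR[OF False])
    ultimately have "latest_written ini S i k x \<in> set ?oth" by (simp only:)
    from all[OF this] show ?thesis by blast
  qed
qed

section \<open>Values forced on reads by opacity\<close>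

lemma serialization_read:
  assumes S: "serialization M E S"
    and w: "\<And>k v. (k, Inv (Write x v)) \<in> set E \<Longrightarrow> k = j \<and> v = nx" "nx \<noteq> tobj_init M x"
    and r: "reads_in E k x v" "k \<noteq> j"
  shows "v = nx \<longleftrightarrow> committed S j \<and> rt_prec S j k \<and> (j, Inv (Write x nx)) \<in> set E"
proof -
  have w': "k = j \<and> v = nx" if "(k, Inv (Write x v)) \<in> set S" for k v
    using w(1) serializationD(3)[OF S, of "Write x v" k] that by blast
  from serializationD(6)[OF S r(1)] obtain i where
    i: "i < length S" "fst (S ! i) = k" "v = latest_written (tobj_init M) S i k x" by blast
  show ?thesis
    unfolding i(3) using latest_written_single_writer[where ini = "tobj_init M", OF w' w(2) r(2) i(1,2)]
      serializationD(3)[OF S, of "Write x nx" j] by simp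
qed

text \<open>Intended for \<open>j\<close> an updater, \<open>w\<close> its overwriter, and
  \<open>a\<close>, \<open>b\<close> the reader and the observer in either order. The read of
  \<open>a\<close> shows that \<open>j\<close> is committed in the serialization. Since
  \<open>j\<close> misses the committed write of \<open>w\<close>, it is serialized before
  \<open>w\<close>, and \<open>w\<close> precedes \<open>b\<close> in real time; so \<open>b\<close>
  sees the write of \<open>j\<close>.\<close>

lemma opaque_cycle:
  assumes "opaque M" "execution M E"
    and x: "\<And>k v. (k, Inv (Write x v)) \<in> set E \<Longrightarrow> k = j \<and> v = nx" "nx \<noteq> tobj_init M x"
    and z: "\<And>k v. (k, Inv (Write z v)) \<in> set E \<Longrightarrow> k = w \<and> v = nz" "nz \<noteq> tobj_init M z"
    and w: "(w, Inv (Write z nz)) \<in> set E" "committed E w" "rt_prec E w b"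
    and j: "reads_in E j z (tobj_init M z)" "w \<noteq> j"
    and a: "reads_in E a x nx" "a \<noteq> j"
    and b: "reads_in E b x v" "b \<noteq> j"
  shows "v = nx"
proof -
  obtain S where S: "serialization M E S"
    using opaque_serialization[OF assms(1,2)] by blast
  from serialization_read[OF S x a] have cj: "committed S j" "(j, Inv (Write x nx)) \<in> set E" by auto
  from serialization_read[OF S z j(1) j(2)[symmetric]] z(2) w(1) serializationD(4)[OF S w(2)]
  have "\<not> rt_prec S w j" by auto
  moreover have "(w, Inv (Write z nz)) \<in> set S" "(j, Inv (Write x nx)) \<in> set S"
    using serializationD(3)[OF S] w(1) cj(2) by blast+
  then have "w \<in> txns S" "j \<in> txns S" by (force simp: txns_def)+
  ultimately have "rt_prec S j w"
    using serializationD(1)[OF S] j(2) by (auto simp: t_sequential_def concurrent_def)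
  from rt_prec_trans[OF this serializationD(2)[OF S w(3)]] have "rt_prec S j b" .
  with serialization_read[OF S x b] cj show "v = nx" by blast
qed

lemma opaque_read_committed:
  assumes "opaque M" "execution M E"
    and x: "\<And>k v. (k, Inv (Write x v)) \<in> set E \<Longrightarrow> k = j \<and> v = nx" "nx \<noteq> tobj_init M x"
    and j: "(j, Inv (Write x nx)) \<in> set E" "committed E j" "rt_prec E j a"
    and a: "reads_in E a x v" "a \<noteq> j"
  shows "v = nx"
proof -
  obtain S where S: "serialization M E S"
    using opaque_serialization[OF assms(1,2)] by blast
  show ?thesis
    using serialization_read[OF S x a] j(1) serializationD(2)[OF S j(3)] serializationD(4)[OF S j(2)]
    by blast
qed

lemma opaque_read_uncommitted:
  assumes "opaque M" "execution M E"
    and x: "\<And>k v. (k, Inv (Write x v)) \<in> set E \<Longrightarrow> k = j \<and> v = nx" "nx \<noteq> tobj_init M x"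
    and j: "(j, Inv TryC) \<notin> set E" "(j, Resp Commit) \<notin> set E"
    and a: "reads_in E a x v" "a \<noteq> j"
  shows "v \<noteq> nx"
proof -
  obtain S where S: "serialization M E S"
    using opaque_serialization[OF assms(1,2)] by blast
  show ?thesis
    using serialization_read[OF S x a] j serializationD(5)[OF S, of j] by blast
qed

lemma opaque_read_unwritten:
  assumes "opaque M" "execution M E" "\<And>k v. (k, Inv (Write x v)) \<notin> set E" "reads_in E a x v"
  shows "v = tobj_init M x"
proof (rule ccontr)
  assume v: "v \<noteq> tobj_init M x"
  obtain S where S: "serialization M E S"
    using opaque_serialization[OF assms(1,2)] by blast
  \<comment> \<open>\<open>serialization_read\<close> asks for a writer other than the reader. As
    nothing is written to \<open>x\<close>, any other identifier will do, with \<open>v\<close>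
    itself as the new value.\<close>
  have "a \<noteq> (Suc (fst a), snd a)" by (metis fst_conv n_not_Suc_n)
  from serialization_read[OF S _ v assms(4) this] assms(3) show False by blast
qed

section \<open>Runs without RAW and AWAR patterns\<close>

definition has_pattern :: "tid \<Rightarrow> ('b, 's, 'r, 'x, 'v) exec \<Rightarrow> bool" where
  "has_pattern k E \<longleftrightarrow> (\<exists>i j. RAW E k i j \<or> i = j \<and> AWAR E k i)"

text \<open>
  The argument \<open>lw\<close> is the base object written last: a run is blind if it reads only what it has
  itself just written.
\<close>

fun blind :: "'b option \<Rightarrow> ('b, 's, 'r, 'x, 'v) exec \<Rightarrow> bool" where
  "blind lw ((k, Prim b pr r) # E) \<longleftrightarrow> (reading_prim pr \<longrightarrow> lw = Some b \<and> trivial_prim pr) \<and>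
     blind (if trivial_prim pr then lw else Some b) E"
| "blind lw (e # E) \<longleftrightarrow> blind lw E"
| "blind lw [] \<longleftrightarrow> True"

text \<open>A primitive that does not read has a constant response and, if nontrivial, writes a
  constant state. A reading one is applied only to the last written object, on which the
  configurations agree. For \<open>lw = None\<close> the rest of the memory may differ
  arbitrarily.\<close>

lemma blind_run:
  assumes "run_from M c F" "blind lw F" "prims_of k F"
    "proc_state c (proc_of k) = proc_state c' (proc_of k)"
    "\<And>b. lw = Some b \<Longrightarrow> base_state c b = base_state c' b"
  shows "run_from M c' F \<and> proc_state (after M c F) (proc_of k) = proc_state (after M c' F) (proc_of k)"
  using assms
proof (induction F arbitrary: c c' lw)
  case (Cons e F)
  from Cons.prems(3) obtain b pr r where e: "e = (k, Prim b pr r)" by auto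
  have next_cmd: "next_cmd M (proc_of k) (proc_state c (proc_of k)) = Apply b pr"
    and r: "r = snd pr (base_state c b)" using Cons.prems(1) by (simp_all add: e)
  have blind: "reading_prim pr \<Longrightarrow> lw = Some b \<and> trivial_prim pr"
    "blind (if trivial_prim pr then lw else Some b) F"
    using Cons.prems(2) by (simp_all add: e)
  have "snd pr (base_state c b) = snd pr (base_state c' b)"
    using blind(1) Cons.prems(5) unfolding reading_prim_def by metis
  with next_cmd r Cons.prems(4) have issued: "issued M c' e" by (simp add: e)
  let ?c = "after_event M c e" and ?c' = "after_event M c' e"
  have "proc_state ?c (proc_of k) = proc_state ?c' (proc_of k)"
    using Cons.prems(4) by (simp add: e upd_proc_def)
  moreover have "base_state ?c b' = base_state ?c' b'"
    if "(if trivial_prim pr then lw else Some b) = Some b'" for b'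
  proof (cases "trivial_prim pr")
    case True
    with that Cons.prems(5) show ?thesis by (auto simp: e upd_proc_def trivial_prim_def)
  next
    case False
    with blind(1) have "\<not> reading_prim pr" by blast
    with False have "fst pr (base_state c b) = fst pr (base_state c' b)"
      unfolding reading_prim_def by metis
    with False that show ?thesis by (simp add: e upd_proc_def)
  qed
  moreover have "run_from M ?c F" "prims_of k F" using Cons.prems(1,3) by simp_all
  ultimately have "run_from M ?c' F \<and>
      proc_state (after M ?c F) (proc_of k) = proc_state (after M ?c' F) (proc_of k)"
    using Cons.IH blind(2) by blast
  with issued show ?case by simp
qed simp

text \<open>A reading nontrivial primitive would be an AWAR; a read of an object other than the last
  written one would form a RAW with that last write. Before any write, the third assumption makes
  the next event nontrivial. In the induction events move from \<open>F\<close> to \<open>G\<close>,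
  so positions in \<open>G @ F @ H\<close> stay fixed.\<close>

lemma blind_if_no_pattern:
  assumes "\<not> has_pattern k (G @ F @ H)" "prims_of k F"
    and "lw = None \<Longrightarrow> F \<noteq> [] \<Longrightarrow> \<exists>b pr r. hd F = (k, Prim b pr r) \<and> nontrivial_prim pr"
    and "\<And>b. lw = Some b \<Longrightarrow> \<exists>i < length G. writes_at (G @ F @ H) k i b \<and>
           (\<forall>l b'. i < l \<and> l < length G \<longrightarrow> \<not> writes_at (G @ F @ H) k l b')"
  shows "blind lw F"
  using assms
proof (induction F arbitrary: G lw)
  case (Cons e F)
  let ?E = "G @ (e # F) @ H"
  from Cons.prems(2) obtain b pr r where e: "e = (k, Prim b pr r)" by auto
  have at: "?E ! length G = e" "length G < length ?E" by simp_all
  have writes: "writes_at ?E k (length G) b' \<longleftrightarrow> b' = b \<and> nontrivial_prim pr" for b'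
    unfolding writes_at_def using at by (auto simp: e)
  have reads: "reads_at ?E k (length G) b" if "reading_prim pr"
    unfolding reads_at_def using that at by (auto simp: e)
  have no: "\<not> RAW ?E k i j" "\<not> AWAR ?E k i" for i j
    using Cons.prems(1) unfolding has_pattern_def by blast+
  have "lw = Some b \<and> trivial_prim pr" if rd: "reading_prim pr"
  proof -
    have triv: "trivial_prim pr"
      using no(2)[of "length G"] writes reads rd unfolding AWAR_def by blast
    with Cons.prems(3) obtain b0 where b0: "lw = Some b0" by (auto simp: e)
    with Cons.prems(4) obtain i where i: "i < length G" "writes_at ?E k i b0"
      "\<And>l b'. i < l \<Longrightarrow> l < length G \<Longrightarrow> \<not> writes_at ?E k l b'" by blast
    have "b = b0"
      using no(1)[of i "length G"] i reads[OF rd] unfolding RAW_def by blast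
    with b0 triv show ?thesis by simp
  qed
  moreover have "blind (if trivial_prim pr then lw else Some b) F"
  proof (rule Cons.IH[of "G @ [e]"])
    show "\<not> has_pattern k ((G @ [e]) @ F @ H)" "prims_of k F" using Cons.prems(1,2) by simp_all
    show "\<exists>b pr r. hd F = (k, Prim b pr r) \<and> nontrivial_prim pr"
      if "(if trivial_prim pr then lw else Some b) = None" "F \<noteq> []"
      using that Cons.prems(3) by (auto simp: e split: if_splits)
    fix b' assume b': "(if trivial_prim pr then lw else Some b) = Some b'"
    show "\<exists>i < length (G @ [e]). writes_at ((G @ [e]) @ F @ H) k i b' \<and>
      (\<forall>l b''. i < l \<and> l < length (G @ [e]) \<longrightarrow> \<not> writes_at ((G @ [e]) @ F @ H) k l b'')"
    proof (cases "trivial_prim pr")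
      case True
      with b' Cons.prems(4) obtain i where i: "i < length G" "writes_at ?E k i b'"
        "\<And>l b'. i < l \<Longrightarrow> l < length G \<Longrightarrow> \<not> writes_at ?E k l b'" by auto
      have "\<not> writes_at ?E k l b''" if "i < l" "l < length (G @ [e])" for l b''
        using that i(3) writes True by (cases "l = length G") auto
      with i show ?thesis by (intro exI[of _ i]) auto
    next
      case False
      with b' writes show ?thesis by (intro exI[of _ "length G"]) auto
    qed
  qed
  ultimately show ?case by (simp add: e)
qed simp

section \<open>Patterns in concatenated executions\<close>

lemma writes_at_append:
  "writes_at (A @ E @ B) k (length A + i) b \<longleftrightarrow> writes_at (E @ B) k i b"
  "reads_at (A @ E @ B) k (length A + i) b \<longleftrightarrow> reads_at (E @ B) k i b"
  by (auto simp: writes_at_def reads_at_def nth_append)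

lemma writes_at_prefix:
  "i < length E \<Longrightarrow> writes_at (E @ B) k i b \<longleftrightarrow> writes_at E k i b"
  "i < length E \<Longrightarrow> reads_at (E @ B) k i b \<longleftrightarrow> reads_at E k i b"
  by (auto simp: writes_at_def reads_at_def nth_append)

lemma pattern_less_length:
  "RAW E k i j \<Longrightarrow> i < length E \<and> j < length E" "AWAR E k i \<Longrightarrow> i < length E"
  by (auto simp: RAW_def AWAR_def writes_at_def reads_at_def)

lemma RAW_prefix: "RAW E k i j \<Longrightarrow> RAW (E @ B) k i j"
  and AWAR_prefix: "AWAR E k i \<Longrightarrow> AWAR (E @ B) k i"
proof -
  assume R: "RAW E k i j"
  then have j: "j < length E" using pattern_less_length by blast
  from R obtain b b' where *: "i < j" "b' \<noteq> b" "writes_at E k i b" "reads_at E k j b'"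
    "\<And>l. i < l \<Longrightarrow> l < j \<Longrightarrow> \<not> writes_at E k l b'" unfolding RAW_def by blast
  with j show "RAW (E @ B) k i j"
    unfolding RAW_def
    by (intro conjI exI[of _ b] exI[of _ b'] allI impI) (auto simp: writes_at_prefix)
next
  assume "AWAR E k i"
  then show "AWAR (E @ B) k i"
    using pattern_less_length[of E k i] by (auto simp: AWAR_def writes_at_prefix)
qed

lemma RAW_shift: "RAW E k i j \<Longrightarrow> RAW (A @ E) k (length A + i) (length A + j)"
  and AWAR_shift: "AWAR E k i \<Longrightarrow> AWAR (A @ E) k (length A + i)"
proof -
  note sh = writes_at_append[where B = "[]", simplified]
  assume "RAW E k i j"
  then obtain b b' where *: "i < j" "b' \<noteq> b" "writes_at E k i b" "reads_at E k j b'"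
    "\<And>l. i < l \<Longrightarrow> l < j \<Longrightarrow> \<not> writes_at E k l b'" unfolding RAW_def by blast
  have "\<not> writes_at (A @ E) k l b'" if "length A + i < l" "l < length A + j" for l
    using *(5)[of "l - length A"] that sh(1)[of A E k "l - length A" b'] by auto
  with * show "RAW (A @ E) k (length A + i) (length A + j)"
    unfolding RAW_def by (intro conjI exI[of _ b] exI[of _ b'] allI impI) (auto simp: sh)
next
  note sh = writes_at_append[where B = "[]", simplified]
  assume "AWAR E k i"
  then show "AWAR (A @ E) k (length A + i)" by (auto simp: AWAR_def sh)
qed

text \<open>Patterns of \<open>A\<close> end before position \<open>length A\<close>, and the new
  one starts no earlier than that.\<close>

lemma performs_RAW_AWARs_append:
  assumes "performs_RAW_AWARs A k N" "has_pattern k E"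
  shows "performs_RAW_AWARs (A @ E) k (Suc N)"
proof -
  from assms(1) obtain R where R: "finite R" "card R = N"
    "\<And>i j. (i, j) \<in> R \<Longrightarrow> RAW A k i j \<or> i = j \<and> AWAR A k i" "pairwise non_overlapping R"
    unfolding performs_RAW_AWARs_def by blast
  from assms(2) obtain i j where ij: "RAW E k i j \<or> i = j \<and> AWAR E k i"
    unfolding has_pattern_def by blast
  let ?p = "(length A + i, length A + j)"
  have less: "snd p < length A" if "p \<in> R" for p
    using R(3)[of "fst p" "snd p"] that pattern_less_length[of A k] by auto
  then have "?p \<notin> R" by fastforce
  moreover have "pairwise non_overlapping (insert ?p R)"
    using R(4) less unfolding pairwise_insert non_overlapping_def by fastforce
  moreover have "\<forall>(i', j')\<in>insert ?p R. RAW (A @ E) k i' j' \<or> i' = j' \<and> AWAR (A @ E) k i'"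
    using R(3) ij RAW_prefix AWAR_prefix RAW_shift AWAR_shift by blast
  moreover have "card (insert ?p R) = Suc N" if "?p \<notin> R" using that R(1,2) by simp
  ultimately show ?thesis
    unfolding performs_RAW_AWARs_def using R(1) by blast
qed

section \<open>Updaters, overwriters, a reader and an observer\<close>

text \<open>The bound \<open>2 * m + 2\<close> counts \<open>m\<close> updaters, \<open>m\<close>
  overwriters, a reader and an observer. \<open>new\<close> chooses for each object the one value
  that may be written to it.\<close>

locale of_tm =
  fixes M :: "('l, 'b, 's, 'r, 'x, 'v) tm" and m :: nat
    and X Z :: "nat \<Rightarrow> 'x" and new :: "'x \<Rightarrow> 'v"
  assumes nprocs: "2 * m + 2 \<le> nprocs M"
    and objs: "\<And>j. j < m \<Longrightarrow> X j \<in> tobjs M" "\<And>j. j < m \<Longrightarrow> Z j \<in> tobjs M"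
    and inj: "\<And>i j. i < m \<Longrightarrow> j < m \<Longrightarrow> X i = X j \<Longrightarrow> i = j"
      "\<And>i j. i < m \<Longrightarrow> j < m \<Longrightarrow> Z i = Z j \<Longrightarrow> i = j"
      "\<And>i j. i < m \<Longrightarrow> j < m \<Longrightarrow> X i \<noteq> Z j"
    and new: "\<And>x. new x \<noteq> tobj_init M x"
    and progress: "OF_progress M" and liveness: "OF_liveness M"
    and opaque: "opaque M" and dap: "RW_DAP M"
begin

text \<open>
  Every process runs at most one transaction, so that well-formedness is a condition on the
  individual transactions only.
\<close>

abbreviation updater :: "nat \<Rightarrow> tid" where "updater j \<equiv> (j, 0)"
abbreviation overwriter :: "nat \<Rightarrow> tid" where "overwriter j \<equiv> (m + j, 0)"
abbreviation reader :: tid where "reader \<equiv> (2 * m, 0)"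
abbreviation observer :: tid where "observer \<equiv> (2 * m + 1, 0)"

text \<open>Two features matter: every object has at most one possible writer, with one possible
  value, as the opacity lemmas require; and every transaction writes at most one object, so that the
  conflict graph has no edges but loops.\<close>

definition allowed :: "tid \<Rightarrow> ('x, 'v) t_op \<Rightarrow> bool" where
  "allowed k opn \<longleftrightarrow>
     (\<exists>j<m. k = updater j \<and> opn \<in> {Read (Z j), Write (X j) (new (X j)), TryC}) \<or>
     (\<exists>j<m. k = overwriter j \<and> opn \<in> {Write (Z j) (new (Z j)), TryC}) \<or>
     (\<exists>j<m. k \<in> {reader, observer} \<and> opn = Read (X j))"

definition admissible :: "('b, 's, 'r, 'x, 'v) exec \<Rightarrow> bool" where
  "admissible E \<longleftrightarrow> run_from M (init_config M) E \<and> (\<forall>k. wf_acts None (proj E k)) \<and>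
     (\<forall>k opn. (k, Inv opn) \<in> set E \<longrightarrow> allowed k opn)"

lemma allowed_tid: "allowed k opn \<Longrightarrow> snd k = 0 \<and> proc_of k < nprocs M \<and> op_objs opn \<subseteq> tobjs M"
  using nprocs objs by (auto simp: allowed_def)

lemma allowed_write:
  assumes "j < m"
  shows "allowed k (Write (X j) v) \<longleftrightarrow> k = updater j \<and> v = new (X j)"
    and "allowed k (Write (Z j) v) \<longleftrightarrow> k = overwriter j \<and> v = new (Z j)"
  using assms inj unfolding allowed_def by fastforce+

lemma admissible_prefix: "admissible (E @ F) \<Longrightarrow> admissible E"
  by (auto simp: admissible_def intro: wf_acts_prefix)

lemma admissible_iff_execution:
  "admissible E \<longleftrightarrow> execution M E \<and> (\<forall>k opn. (k, Inv opn) \<in> set E \<longrightarrow> allowed k opn)"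
proof
  assume A: "admissible E"
  then have tid: "snd k = 0 \<and> proc_of k < nprocs M" if "k \<in> txns E" for k
    using first_event_inv[OF _ that] allowed_tid unfolding admissible_def by metis
  moreover have "k = k'" if "k \<in> txns E" "k' \<in> txns E" "proc_of k = proc_of k'" for k k'
    using tid that by (simp add: prod_eq_iff)
  ultimately show "execution M E \<and> (\<forall>k opn. (k, Inv opn) \<in> set E \<longrightarrow> allowed k opn)"
    using A allowed_tid unfolding admissible_def execution_def well_formed_def by blast
next
  assume A: "execution M E \<and> (\<forall>k opn. (k, Inv opn) \<in> set E \<longrightarrow> allowed k opn)"
  have "wf_acts None (proj E k)" for k
  proof (cases "k \<in> txns E")
    case True
    then show ?thesis using A unfolding execution_def well_formed_def by blast
  next
    case False
    then show ?thesis by (metis proj_eq_Nil_iff wf_acts.simps(1))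
  qed
  with A show "admissible E" unfolding admissible_def execution_def by blast
qed

lemma admissible_execution: "admissible E \<Longrightarrow> execution M E"
  by (simp add: admissible_iff_execution)

lemma admissible_writes:
  assumes "admissible E" "j < m"
  shows "(k, Inv (Write (X j) v)) \<in> set E \<Longrightarrow> k = updater j \<and> v = new (X j)"
    and "(k, Inv (Write (Z j) v)) \<in> set E \<Longrightarrow> k = overwriter j \<and> v = new (Z j)"
  using assms allowed_write unfolding admissible_def by blast+

section \<open>Extending admissible executions by one operation\<close>

definition idle :: "('b, 's, 'r, 'x, 'v) exec \<Rightarrow> tid \<Rightarrow> bool" where
  "idle E k \<longleftrightarrow> proj E k = [] \<or> (\<exists>res. last (proj E k) = Resp res \<and> res \<notin> {Commit, Abort})"

lemma idle_op_run: "res \<notin> {Commit, Abort} \<Longrightarrow> idle (E @ op_run k opn F res) k"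
  by (simp add: idle_def)

lemma admissible_inv:
  assumes "admissible E" "allowed k opn" "idle E k"
  shows "admissible (E @ [(k, Inv opn)])"
proof -
  have "wf_acts None (proj E k @ [Inv opn])"
  proof (cases "proj E k = []")
    case False
    with assms(3) obtain res where "last (proj E k) = Resp res" "res \<notin> {Commit, Abort}"
      by (auto simp: idle_def)
    with False assms(1) show ?thesis
      using wf_acts_append[of None "proj E k" res "[Inv opn]"] by (simp add: admissible_def)
  qed (simp del: proj_eq_Nil_iff)
  with assms show ?thesis by (auto simp: admissible_def)
qed

text \<open>Liveness supplies the steps and the response. All events of \<open>k\<close> lie in
  \<open>B\<close> and the new operation, so they are contiguous and progress rules out an
  abort.\<close>

lemma admissible_op:
  assumes "admissible (A @ B)" "k \<notin> txns A" "txns B \<subseteq> {k}" "idle (A @ B) k" "allowed k opn"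
  obtains F res where "prims_of k F" "admissible (A @ B @ op_run k opn F res)"
    "matching opn res" "res \<noteq> Abort"
proof -
  from admissible_inv[OF assms(1,5,4)] have "admissible ((A @ B) @ [(k, Inv opn)])" .
  with liveness obtain F res where F: "\<forall>e\<in>set F. \<exists>b pr r. e = (k, Prim b pr r)"
    "execution M ((A @ B) @ [(k, Inv opn)] @ F @ [(k, Resp res)])"
    unfolding OF_liveness_def using admissible_execution by blast
  let ?E = "A @ B @ op_run k opn F res"
  have pF: "prims_of k F" using F(1) by (simp add: prims_of_def)
  have "(k', Inv opn') \<in> set ?E \<Longrightarrow> allowed k' opn'" for k' opn'
    using assms(1,5) prims_of_inv[OF pF] by (auto simp: admissible_def)
  with F(2) have adm: "admissible ?E" by (simp add: admissible_iff_execution)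
  have "proj ?E k = proj (A @ B) k @ Inv opn # proj F k @ Resp res # []" by simp
  moreover have "\<exists>b pr r. a = Prim b pr r" if "a \<in> set (proj F k)" for a
    using that F(1) by auto
  moreover have "wf_acts None (proj ?E k)" using adm by (simp only: admissible_def)
  ultimately have matching: "matching opn res" using wf_acts_matching by metis
  have "step_contention_free ?E k"
    unfolding step_contention_free_def using assms(2,3) prims_of_txns[OF pF]
    by (intro exI[of _ A] exI[of _ "B @ op_run k opn F res"] exI[of _ "[]"]) auto
  with progress F(2) have "(k, Resp Abort) \<notin> set ?E" unfolding OF_progress_def by auto
  then have "res \<noteq> Abort" by auto
  with that pF adm matching show thesis by blast
qed

lemma admissible_read:
  assumes "admissible (A @ B)" "k \<notin> txns A" "txns B \<subseteq> {k}" "idle (A @ B) k" "allowed k (Read x)"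
  obtains F v where "prims_of k F" "admissible (A @ B @ op_run k (Read x) F (Val v))"
  using admissible_op[OF assms] by (metis matching.simps(1))

section \<open>Disjoint-access parallelism\<close>

lemma Wset_singleton:
  assumes "admissible E" "x \<in> Wset E k" "y \<in> Wset E k"
  shows "x = y"
proof -
  from assms obtain v w where "allowed k (Write x v)" "allowed k (Write y w)"
    unfolding admissible_def Wset_def by blast
  then show ?thesis unfolding allowed_def by auto
qed

text \<open>Since write sets have at most one element, paths in the conflict graph are constant.
  Disjoint data sets are then also not connected.\<close>

lemma no_contention:
  assumes E: "admissible E" and k: "k \<in> txns E" "k' \<in> txns E" "k \<noteq> k'"
    and disj: "Dset E k \<inter> Dset E k' = {}"
  shows "\<not> contend E k k' b"
proof
  assume "contend E k k' b"
  with dap E k disj have "\<not> rw_disjoint_access E k k'"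
    unfolding RW_DAP_def using admissible_execution by blast
  then obtain x y where xy: "x \<in> Dset E k" "y \<in> Dset E k'" "(x, y) \<in> (conflict_edges E k k')\<^sup>*"
    unfolding rw_disjoint_access_def by blast
  have "conflict_edges E k k' \<subseteq> Id"
    using Wset_singleton[OF E] unfolding conflict_edges_def by auto
  from xy(3) this have "x = y" by (induction rule: rtrancl_induct) auto
  with xy disj show False by blast
qed

text \<open>The data set of the observer is at most \<open>X j\<close>, and that of \<open>k\<close>
  does not grow during \<open>D\<close>. A nontrivial primitive of \<open>k\<close> on an object
  accessed in \<open>D\<close> would thus be forbidden contention.\<close>

lemma observer_trivial:
  assumes E: "admissible (E @ D)" "observer \<notin> txns E"
    and D: "D = op_run observer (Read (X j)) F res" "prims_of observer F"
    and k: "(k, Prim b pr r) \<in> set E" "X j \<notin> Dset E k" and b: "b \<in> accessed D"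
  shows "trivial_prim pr"
proof (rule ccontr)
  assume nontriv: "nontrivial_prim pr"
  have kE: "k \<in> txns E" using k(1) by (force simp: txns_def)
  with E(2) have ne: "k \<noteq> observer" by blast
  have D_events: "a = Inv (Read (X j)) \<or> a = Resp res \<or> (\<exists>b pr r. a = Prim b pr r)" "k' = observer"
    if "(k', a) \<in> set D" for k' a
    using that D by (auto simp: prims_of_def)
  have "(observer, a) \<notin> set E" for a using E(2) by (force simp: txns_def)
  then have "Dset (E @ D) observer \<subseteq> {X j}"
    using D_events by (fastforce simp: Dset_def Rset_def Wset_def)
  moreover have "Dset (E @ D) k = Dset E k"
  proof -
    have "(k, a) \<notin> set D" for a using D_events(2) ne by blast
    then show ?thesis by (simp add: Dset_def Rset_def Wset_def)
  qed
  ultimately have "Dset (E @ D) k \<inter> Dset (E @ D) observer = {}" using k(2) by blast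
  from no_contention[OF E(1) _ _ ne this, of b] kE D(1)
  have "\<not> contend (E @ D) k observer b" by simp
  moreover obtain k' pr' r' where "(k', Prim b pr' r') \<in> set D" using b by (auto simp: accessed_def)
  moreover from this D_events(2) have "k' = observer" by blast
  ultimately show False using k(1) nontriv unfolding contend_def by fastforce
qed

text \<open>
  By disjoint-access parallelism the observer does not contend with \<open>V\<close>, hence it takes the same
  steps in the configuration \<open>c\<close> that lacks \<open>V\<close>.
\<close>

lemma observer_transfer:
  assumes E: "admissible E" "observer \<notin> txns E" and j: "j < m"
    and V: "set V \<subseteq> set E" "\<And>k. k \<in> txns V \<Longrightarrow> X j \<notin> Dset E k"
    and agree: "\<And>B. \<forall>b\<in>B. trivial_on V b \<Longrightarrow> agree {proc_of observer} B (conf M E) c"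
    and D: "D = op_run observer (Read (X j)) F res" "prims_of observer F" and run: "run_from M c D"
  shows "admissible (E @ D)" "\<And>b. b \<in> accessed D \<Longrightarrow> trivial_on V b"
proof -
  have "idle (E @ []) observer" using E(2) by (simp add: idle_def)
  moreover have "allowed observer (Read (X j))" using j by (auto simp: allowed_def)
  ultimately obtain F' v where F': "prims_of observer F'"
    "admissible (E @ [] @ op_run observer (Read (X j)) F' (Val v))"
    using admissible_read[of E "[]" observer "X j"] E by auto
  \<comment> \<open>Disjoint-access parallelism speaks of executions only, and \<open>D\<close> is
    not yet known to extend \<open>E\<close>. So it is applied to the run \<open>D'\<close> that
    liveness provides after \<open>E\<close>; this run carries over to \<open>c\<close>, where
    determinism identifies it with \<open>D\<close>.\<close>
  define D' where "D' = op_run observer (Read (X j)) F' (Val v)"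
  have adm: "admissible (E @ D')" using F'(2) by (simp add: D'_def)
  have triv: "trivial_on V b" if "b \<in> accessed D'" for b
    unfolding trivial_on_def
  proof (intro allI impI)
    fix k pr r assume kb: "(k, Prim b pr r) \<in> set V"
    then have "k \<in> txns V" by (force simp: txns_def)
    with kb V observer_trivial[OF adm E(2) D'_def F'(1) _ _ that] show "trivial_prim pr" by blast
  qed
  then have "agree {proc_of observer} (accessed D') (conf M E) c" using agree by blast
  moreover have "procs D' \<subseteq> {proc_of observer}"
    using F'(1) by (auto simp: D'_def procs_def txns_def prims_of_def)
  moreover have "run_from M (conf M E) D'" using adm by (simp add: admissible_def)
  ultimately have "run_from M c D'" using agree_run by blast
  with run have "D' = D"
    using op_run_deterministic[of M c observer "Read (X j)" F res F' "Val v"] D F'(1)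
    by (simp add: D'_def)
  with adm triv show "admissible (E @ D)" "\<And>b. b \<in> accessed D \<Longrightarrow> trivial_on V b" by blast+
qed

section \<open>Critical steps of the updaters\<close>

text \<open>
  After \<open>C\<close>, the event \<open>e\<close> of updater \<open>j\<close> is about to make its write visible to the observer.
\<close>

definition critical ::
  "nat \<Rightarrow> ('b, 's, 'r, 'x, 'v) exec \<Rightarrow> ('b, 's, 'r, 'x, 'v) event \<Rightarrow> bool" where
  "critical j C e \<longleftrightarrow> admissible (C @ [e]) \<and> reads_in C (updater j) (Z j) (tobj_init M (Z j)) \<and>
     (\<exists>b pr r F\<^sub>1 v\<^sub>1 F\<^sub>2. e = (updater j, Prim b pr r) \<and> prims_of observer F\<^sub>1 \<and> prims_of observer F\<^sub>2 \<and>
        b \<in> accessed F\<^sub>1 \<and> v\<^sub>1 \<noteq> new (X j) \<and>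
        run_from M (conf M C) (op_run observer (Read (X j)) F\<^sub>1 (Val v\<^sub>1)) \<and>
        run_from M (conf M (C @ [e])) (op_run observer (Read (X j)) F\<^sub>2 (Val (new (X j)))))"

text \<open>Running alone, the updater reads, writes and commits. A read by the observer returns the
  new value after the whole \<open>tryC\<close> but not before it, so some single event of
  \<open>tryC\<close> makes the difference.\<close>

lemma critical_prefix:
  assumes A: "admissible A" and j: "j < m"
    and fresh: "updater j \<notin> txns A" "overwriter j \<notin> txns A" "observer \<notin> txns A"
  obtains P e where "txns P \<subseteq> {updater j}" "critical j (A @ P) e"
proof -
  let ?u = "updater j"
  have allowed: "allowed ?u (Read (Z j))" "allowed ?u (Write (X j) (new (X j)))" "allowed ?u TryC"
    "allowed observer (Read (X j))"
    using j by (auto simp: allowed_def)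
  have idle0: "idle (A @ []) ?u" using fresh(1) by (simp add: idle_def)
  obtain F1 z where F1: "prims_of ?u F1" "admissible (A @ [] @ op_run ?u (Read (Z j)) F1 (Val z))"
    using admissible_read[OF _ fresh(1) _ idle0 allowed(1)] A by auto
  define G1 where "G1 = op_run ?u (Read (Z j)) F1 (Val z)"
  have G1: "admissible (A @ G1)" "txns G1 \<subseteq> {?u}" "idle (A @ G1) ?u"
    "reads_in (A @ G1) ?u (Z j) z" "(?u, Inv TryC) \<notin> set G1" "(?u, Resp Commit) \<notin> set G1"
    using F1 prims_of_txns[OF F1(1)] idle_op_run[of "Val z"] reads_in_op_run[OF F1(1), of A "Z j" z "[]"]
      prims_of_inv[OF F1(1)] prims_of_resp[OF F1(1)]
    by (auto simp: G1_def)
  \<comment> \<open>The only possible writer of \<open>Z j\<close> has not started.\<close>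
  have "z = tobj_init M (Z j)"
  proof (rule opaque_read_unwritten[OF opaque admissible_execution[OF G1(1)] _ G1(4)])
    show "(k, Inv (Write (Z j) v)) \<notin> set (A @ G1)" for k v
      using admissible_writes(2)[OF G1(1) j, of k v] fresh(2) G1(2) j by (force simp: txns_def)
  qed
  with G1(4) have z: "reads_in (A @ G1) ?u (Z j) (tobj_init M (Z j))" by simp
  obtain F2 res where F2: "prims_of ?u F2"
    "admissible (A @ G1 @ op_run ?u (Write (X j) (new (X j))) F2 res)"
    "matching (Write (X j) (new (X j))) res" "res \<noteq> Abort"
    using admissible_op[OF G1(1) fresh(1) G1(2,3) allowed(2)] by blast
  define G2 where "G2 = op_run ?u (Write (X j) (new (X j))) F2 res"
  have res: "res = Ok" using F2(3,4) by simp
  have G2: "admissible (A @ G1 @ G2)" "txns G2 \<subseteq> {?u}" "idle (A @ G1 @ G2) ?u"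
    "(?u, Inv TryC) \<notin> set G2" "(?u, Resp Commit) \<notin> set G2"
    "(?u, Inv (Write (X j) (new (X j)))) \<in> set G2"
    using F2 prims_of_txns[OF F2(1)] idle_op_run[of Ok "A @ G1"] res
      prims_of_inv[OF F2(1)] prims_of_resp[OF F2(1)]
    by (auto simp: G2_def)
  have G12: "txns (G1 @ G2) \<subseteq> {?u}" using G1(2) G2(2) by simp
  obtain F3 res' where F3: "prims_of ?u F3"
    "admissible (A @ (G1 @ G2) @ op_run ?u TryC F3 res')" "matching (TryC :: ('x, 'v) t_op) res'" "res' \<noteq> Abort"
    using admissible_op[OF _ fresh(1) G12 _ allowed(3)] G2(1,3) by blast
  define G3 where "G3 = op_run ?u TryC F3 res'"
  have res': "res' = Commit" using F3(3,4) by simp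
  define H where "H = A @ G1 @ G2"
  have G3: "admissible (H @ G3)" "txns G3 \<subseteq> {?u}" "committed (H @ G3) ?u"
  proof -
    show "admissible (H @ G3)" using F3(2) by (simp add: G3_def H_def)
    show "txns G3 \<subseteq> {?u}" using prims_of_txns[OF F3(1)] by (simp add: G3_def)
    have "proj (H @ G3) ?u = proj (H @ [(?u, Inv TryC)] @ F3) ?u @ [Resp Commit]"
      by (simp add: G3_def res')
    then show "committed (H @ G3) ?u" unfolding committed_def by (metis last_snoc snoc_eq_iff_butlast)
  qed
  \<comment> \<open>The index counts all events of \<open>tryC\<close>, including its invocation and
    its response.\<close>
  define visible where "visible i \<longleftrightarrow> (\<exists>F. prims_of observer F \<and>
    admissible ((H @ take i G3) @ op_run observer (Read (X j)) F (Val (new (X j)))))" for i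
  have take_G3: "txns (take i G3) \<subseteq> {?u}" for i
    using G3(2) image_mono[OF set_take_subset[of i G3], of fst] unfolding txns_def by blast
  have obs: "observer \<notin> txns (H @ take i G3)" for i
    using take_G3[of i] fresh(3) G12 j by (auto simp: H_def)
  have u_ne: "observer \<noteq> ?u" using j by simp
  have adm_take: "admissible (H @ take i G3)" for i
    using admissible_prefix[of "H @ take i G3" "drop i G3"] G3(1) by simp
  have op: "\<exists>F v. prims_of observer F \<and>
    admissible ((H @ take i G3) @ op_run observer (Read (X j)) F (Val v))" for i
  proof -
    have "idle ((H @ take i G3) @ []) observer" unfolding idle_def using obs by simp
    then obtain F v where "prims_of observer F"
      "admissible ((H @ take i G3) @ [] @ op_run observer (Read (X j)) F (Val v))"
      using admissible_read[OF _ obs _ _ allowed(4), of i "[]"] adm_take[of i] by (metis append_Nil2 empty_subsetI txns_simps(1))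
    then show ?thesis by auto
  qed
  \<comment> \<open>After \<open>H\<close>, \<open>tryC\<close> has not been invoked, so no
    completion commits the updater.\<close>
  have "\<not> visible 0"
  proof
    assume "visible 0"
    then obtain F where F: "prims_of observer F"
      "admissible (H @ op_run observer (Read (X j)) F (Val (new (X j))))" (is "admissible ?E")
      by (auto simp: visible_def)
    have "(?u, a) \<notin> set A" for a using fresh(1) by (force simp: txns_def)
    then have noc: "(?u, Inv TryC) \<notin> set ?E" "(?u, Resp Commit) \<notin> set ?E"
      using G1(5,6) G2(4,5) prims_of_inv[OF F(1)] prims_of_resp[OF F(1)] u_ne
      by (auto simp: H_def)
    have "reads_in ?E observer (X j) (new (X j))"
      using reads_in_op_run[OF F(1), of H _ _ "[]"] by simp
    from opaque_read_uncommitted[OF opaque admissible_execution[OF F(2)]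
        admissible_writes(1)[OF F(2) j] new noc this u_ne] show False by simp
  qed
  \<comment> \<open>After \<open>G3\<close> the updater is committed and precedes the observer in
    real time.\<close>
  moreover have "visible (length G3)"
  proof -
    from op[of "length G3"] obtain F v where F: "prims_of observer F"
      "admissible ((H @ G3) @ op_run observer (Read (X j)) F (Val v))" (is "admissible (_ @ ?D)") by auto
    let ?E = "(H @ G3) @ ?D"
    have "?u \<notin> txns ?D" using prims_of_txns[OF F(1)] u_ne by auto
    moreover from this have "committed ?E ?u"
      using G3(3) proj_eq_Nil_iff[of ?D ?u] unfolding committed_def
      by (metis append_Nil2 proj_simps(2))
    moreover have "observer \<notin> txns (H @ G3)" using obs[of "length G3"] by simp
    ultimately have "rt_prec ?E ?u observer"
      using G3(3) by (intro rt_prec_appendI) (auto simp: t_complete_def)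
    moreover have "(?u, Inv (Write (X j) (new (X j)))) \<in> set ?E" using G2(6) by (simp add: H_def)
    moreover have "reads_in ?E observer (X j) v"
      using reads_in_op_run[OF F(1), of "H @ G3" _ _ "[]"] by simp
    ultimately have "v = new (X j)"
      using opaque_read_committed[OF opaque admissible_execution[OF F(2)]
        admissible_writes(1)[OF F(2) j] new _ \<open>committed ?E ?u\<close> _ _ u_ne] by blast
    with F show ?thesis by (auto simp: visible_def)
  qed
  ultimately obtain i where i: "i < length G3" "\<not> visible i" "visible (Suc i)"
    using ex_least_nat_less[of visible "length G3"] by blast
  define P where "P = G1 @ G2 @ take i G3"
  define e where "e = G3 ! i"
  have C: "A @ P = H @ take i G3" "(A @ P) @ [e] = H @ take (Suc i) G3"
    using i(1) by (simp_all add: P_def H_def e_def take_Suc_conv_app_nth)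
  from op[of i] obtain F\<^sub>1 v\<^sub>1 where F\<^sub>1: "prims_of observer F\<^sub>1"
    "admissible ((A @ P) @ op_run observer (Read (X j)) F\<^sub>1 (Val v\<^sub>1))" unfolding C(1) by blast
  from i(3) obtain F\<^sub>2 where F\<^sub>2: "prims_of observer F\<^sub>2"
    "admissible (((A @ P) @ [e]) @ op_run observer (Read (X j)) F\<^sub>2 (Val (new (X j))))"
    unfolding visible_def C(2)[symmetric] by blast
  have v\<^sub>1: "v\<^sub>1 \<noteq> new (X j)" using i(2) F\<^sub>1 unfolding visible_def C(1) by blast
  let ?c = "conf M (A @ P)" and ?c' = "conf M ((A @ P) @ [e])"
  let ?D\<^sub>1 = "op_run observer (Read (X j)) F\<^sub>1 (Val v\<^sub>1)"
  have run\<^sub>1: "run_from M ?c ?D\<^sub>1" using F\<^sub>1(2) unfolding admissible_def run_from_append by blast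
  have run\<^sub>2: "run_from M ?c' (op_run observer (Read (X j)) F\<^sub>2 (Val (new (X j))))"
    using F\<^sub>2(2) unfolding admissible_def run_from_append[of M _ "(A @ P) @ [e]"] by blast
  have eu: "fst e = ?u" using i(1) G3(2) unfolding e_def txns_def by (meson image_subset_iff nth_mem singletonD)
  \<comment> \<open>Otherwise \<open>e\<close> would change nothing that the first observer run
    accesses; this run would then also be possible after \<open>e\<close>, against determinism, as
    the two answers differ.\<close>
  have "\<exists>b pr r. e = (?u, Prim b pr r) \<and> b \<in> accessed F\<^sub>1"
  proof (rule ccontr)
    assume no: "\<not> ?thesis"
    have "agree {proc_of observer} (accessed ?D\<^sub>1) ?c (after M ?c [e])"
    proof (rule agree_after)
      show "{proc_of observer} \<inter> procs [e] = {}" using eu u_ne by (cases e) auto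
      show "trivial_on [e] b" if "b \<in> accessed ?D\<^sub>1" for b
        using no that eu by (auto simp: trivial_on_def)
    qed
    moreover have "procs ?D\<^sub>1 \<subseteq> {proc_of observer}"
      using prims_of_txns[OF F\<^sub>1(1)] by (auto simp: procs_def)
    ultimately have "run_from M ?c' ?D\<^sub>1" using agree_run[OF run\<^sub>1] by simp
    from op_run_deterministic(2)[OF this run\<^sub>2 F\<^sub>1(1) F\<^sub>2(1)] v\<^sub>1 show False by simp
  qed
  then obtain b pr r where e: "e = (?u, Prim b pr r)" "b \<in> accessed F\<^sub>1" by blast
  have "reads_in (A @ P) ?u (Z j) (tobj_init M (Z j))"
    using reads_in_append[OF z, of "G2 @ take i G3"] by (simp add: P_def)
  moreover have "admissible ((A @ P) @ [e])" unfolding C(2) by (rule adm_take)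
  ultimately have "critical j (A @ P) e"
    unfolding critical_def using e F\<^sub>1(1) F\<^sub>2(1) v\<^sub>1 run\<^sub>1 run\<^sub>2 by blast
  moreover have "txns P \<subseteq> {?u}"
    using G12 take_G3[of i] by (simp add: P_def)
  ultimately show thesis by (rule that[rotated])
qed

section \<open>Inserting steps into the operations of the reader\<close>

lemma admissible_tid: "admissible E \<Longrightarrow> k \<in> txns E \<Longrightarrow> snd k = 0"
  using first_event_inv[of E k] allowed_tid unfolding admissible_def by metis

lemma not_in_procs:
  assumes "admissible E" "txns V \<subseteq> txns E" "(p, 0) \<notin> txns V"
  shows "p \<notin> procs V"
proof
  assume "p \<in> procs V"
  then obtain q where q: "(p, q) \<in> txns V" by (auto simp: procs_def)
  with assms admissible_tid[of E "(p, q)"] show False by auto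
qed

text \<open>\<open>V\<close> stands for whatever happens after the updater is stopped. The observer
  does not contend with it, so both observer runs persist. Since the first of them accesses the base
  object of \<open>e\<close>, \<open>V\<close> is trivial on that object as well, and
  \<open>e\<close> can still be taken with the same response.\<close>

lemma critical_transfer:
  assumes E: "admissible (C @ V)" "observer \<notin> txns (C @ V)" and j: "j < m"
    and crit: "critical j C e"
    and V: "updater j \<notin> txns V" "\<And>k. k \<in> txns V \<Longrightarrow> X j \<notin> Dset (C @ V) k"
  obtains F\<^sub>1 v\<^sub>1 F\<^sub>2 where "prims_of observer F\<^sub>1" "prims_of observer F\<^sub>2"
    "v\<^sub>1 \<noteq> new (X j)" "fst e = updater j"
    "admissible ((C @ V) @ op_run observer (Read (X j)) F\<^sub>1 (Val v\<^sub>1))"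
    "admissible ((C @ V) @ e # op_run observer (Read (X j)) F\<^sub>2 (Val (new (X j))))"
proof -
  let ?u = "updater j"
  from crit obtain b pr r F\<^sub>1 v\<^sub>1 F\<^sub>2 where e: "e = (?u, Prim b pr r)" "admissible (C @ [e])"
    and F: "prims_of observer F\<^sub>1" "prims_of observer F\<^sub>2" "b \<in> accessed F\<^sub>1" "v\<^sub>1 \<noteq> new (X j)"
    and run: "run_from M (conf M C) (op_run observer (Read (X j)) F\<^sub>1 (Val v\<^sub>1))"
      "run_from M (conf M (C @ [e])) (op_run observer (Read (X j)) F\<^sub>2 (Val (new (X j))))"
    unfolding critical_def by blast
  have procs: "proc_of observer \<notin> procs V" "proc_of ?u \<notin> procs V"
    using not_in_procs[OF E(1), of V] E(2) V(1) by auto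
  have agree: "agree {proc_of observer, proc_of ?u} B (conf M (C @ V)) (conf M C)"
    if "\<forall>b\<in>B. trivial_on V b" for B
  proof -
    have "agree {proc_of observer, proc_of ?u} B (conf M C) (after M (conf M C) V)"
      using that procs by (intro agree_after) auto
    then show ?thesis by (simp add: agree_sym)
  qed
  have "agree {proc_of observer} B (conf M (C @ V)) (conf M C)" if "\<forall>b\<in>B. trivial_on V b" for B
    using agree_mono[OF agree[OF that], of "{proc_of observer}" B] by blast
  note transfer1 = observer_transfer[OF E j _ V(2) this refl F(1) run(1)]
  have D\<^sub>1: "admissible ((C @ V) @ op_run observer (Read (X j)) F\<^sub>1 (Val v\<^sub>1))"
    by (rule transfer1(1)) auto
  have triv: "trivial_on V b"
    by (rule transfer1(2)) (use F(3) in auto)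
  have "run_from M (conf M C) [e]" using e(2) by (simp add: admissible_def)
  moreover have "agree {proc_of observer, proc_of ?u} {b} (conf M C) (conf M (C @ V))"
    using agree triv by (simp add: agree_sym)
  ultimately have run_e: "run_from M (conf M (C @ V)) [e]"
    by (rule agree_run) (simp_all add: e(1))
  have adm_e: "admissible ((C @ V) @ [e])"
    unfolding admissible_def
  proof (intro conjI allI impI)
    show "run_from M (init_config M) ((C @ V) @ [e])"
      using run_e E(1) unfolding admissible_def run_from_append by simp
    show "wf_acts None (proj ((C @ V) @ [e]) k)" for k
    proof (cases "k = ?u")
      case True
      then have "proj ((C @ V) @ [e]) k = proj (C @ [e]) k" using V(1) by simp
      with e(2) show ?thesis unfolding admissible_def by metis
    next
      case False
      then have "proj ((C @ V) @ [e]) k = proj (C @ V) k" by (simp add: e(1))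
      with E(1) show ?thesis unfolding admissible_def by metis
    qed
    show "allowed k opn" if "(k, Inv opn) \<in> set ((C @ V) @ [e])" for k opn
      using that E(1) by (auto simp: e(1) admissible_def)
  qed
  have "agree {proc_of observer} B (conf M ((C @ V) @ [e])) (conf M (C @ [e]))"
    if "\<forall>b\<in>B. trivial_on V b" for B
  proof -
    \<comment> \<open>The object \<open>b\<close> is included so that \<open>e\<close> has the same
      effect in both configurations.\<close>
    have "agree {proc_of observer, proc_of ?u} (insert b B) (conf M (C @ V)) (conf M C)"
      using agree that triv by blast
    then have "agree {proc_of observer, proc_of ?u} (insert b B)
        (after_event M (conf M (C @ V)) e) (after_event M (conf M C) e)"
      by (rule agree_step) (auto simp: e(1))
    from agree_mono[OF this, of "{proc_of observer}" B] show ?thesis by auto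
  qed
  moreover have "X j \<notin> Dset ((C @ V) @ [e]) k" if "k \<in> txns V" for k
    using V(2)[OF that] by (auto simp: Dset_def Rset_def Wset_def e(1))
  moreover have "observer \<notin> txns ((C @ V) @ [e])" using E(2) j by (auto simp: e(1))
  ultimately have "admissible (((C @ V) @ [e]) @ op_run observer (Read (X j)) F\<^sub>2 (Val (new (X j))))"
    using observer_transfer(1)[OF adm_e _ j _ _ _ refl F(2) run(2), of V] by auto
  then show thesis using that F(1,2,4) D\<^sub>1 by (simp add: e(1))
qed

section \<open>Stopping all updaters and running all overwriters\<close>

definition prepared :: "nat \<Rightarrow> ('b, 's, 'r, 'x, 'v) exec \<Rightarrow> bool" where
  "prepared j U \<longleftrightarrow> (\<exists>C e V. U = C @ V \<and> critical j C e \<and> updater j \<notin> txns V) \<and>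
     committed U (overwriter j) \<and> (overwriter j, Inv (Write (Z j) (new (Z j)))) \<in> set U"

lemma committed_append: "committed E k \<Longrightarrow> k \<notin> txns F \<Longrightarrow> committed (E @ F) k"
  unfolding committed_def by (metis append_Nil2 proj_eq_Nil_iff proj_simps(2))

lemma prepared_append:
  assumes "prepared j U" "updater j \<notin> txns W" "overwriter j \<notin> txns W"
  shows "prepared j (U @ W)"
  using assms unfolding prepared_def by (fastforce intro: committed_append)

text \<open>An overwriter running alone cannot abort, whichever transactions of \<open>A\<close> are
  left unfinished; in particular a stopped updater does not block it.\<close>

lemma overwrite:
  assumes A: "admissible A" and j: "j < m" and fresh: "overwriter j \<notin> txns A"
  obtains W where "txns W \<subseteq> {overwriter j}" "admissible (A @ W)" "committed (A @ W) (overwriter j)"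
    "(overwriter j, Inv (Write (Z j) (new (Z j)))) \<in> set W"
proof -
  let ?w = "overwriter j"
  have allowed: "allowed ?w (Write (Z j) (new (Z j)))" "allowed ?w TryC"
    using j by (auto simp: allowed_def)
  have idle0: "idle (A @ []) ?w" using fresh by (simp add: idle_def)
  obtain F res where F: "prims_of ?w F"
    "admissible (A @ [] @ op_run ?w (Write (Z j) (new (Z j))) F res)"
    "matching (Write (Z j) (new (Z j))) res" "res \<noteq> Abort"
    using admissible_op[OF _ fresh _ idle0 allowed(1)] A by auto
  define W1 where "W1 = op_run ?w (Write (Z j) (new (Z j))) F res"
  have res: "res = Ok" using F(3,4) by simp
  have W1: "admissible (A @ W1)" "txns W1 \<subseteq> {?w}" "idle (A @ W1) ?w"
    using F(2) prims_of_txns[OF F(1)] idle_op_run[of Ok A] res by (auto simp: W1_def)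
  obtain F' res' where F': "prims_of ?w F'" "admissible (A @ W1 @ op_run ?w TryC F' res')"
    "matching (TryC :: ('x, 'v) t_op) res'" "res' \<noteq> Abort"
    using admissible_op[OF W1(1) fresh W1(2,3) allowed(2)] by blast
  define W where "W = W1 @ op_run ?w TryC F' res'"
  have "proj (A @ W) ?w = proj (A @ W1 @ [(?w, Inv TryC)] @ F') ?w @ [Resp Commit]"
    using F'(3,4) by (simp add: W_def)
  then have "committed (A @ W) ?w" unfolding committed_def by (metis last_snoc snoc_eq_iff_butlast)
  moreover have "txns W \<subseteq> {?w}" using W1(2) prims_of_txns[OF F'(1)] by (simp add: W_def)
  moreover have "admissible (A @ W)" using F'(2) by (simp add: W_def)
  ultimately show thesis by (intro that[of W]) (auto simp: W_def W1_def)
qed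

abbreviation "writers l \<equiv> updater ` {..<l} \<union> overwriter ` {..<l}"

text \<open>One index at a time: updater \<open>l\<close> stops before its critical step, then
  overwriter \<open>l\<close> commits. Later steps belong to other transactions, so what has been
  prepared stays prepared.\<close>

lemma prepared_exists:
  assumes "l \<le> m"
  shows "\<exists>U. admissible U \<and> txns U \<subseteq> writers l \<and> (\<forall>j<l. prepared j U)"
  using assms
proof (induction l)
  case 0
  have "admissible []" by (simp add: admissible_def del: proj_eq_Nil_iff)
  then show ?case by (intro exI[of _ "[]"]) simp
next
  case (Suc l)
  then obtain U where U: "admissible U" "txns U \<subseteq> writers l" "\<And>j. j < l \<Longrightarrow> prepared j U" by auto
  have l: "l < m" using Suc.prems by simp
  have fresh: "updater l \<notin> txns U" "overwriter l \<notin> txns U" "observer \<notin> txns U"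
    using U(2) l by auto
  obtain P e where P: "txns P \<subseteq> {updater l}" "critical l (U @ P) e"
    using critical_prefix[OF U(1) l fresh] .
  have UP: "admissible (U @ P)" using P(2) admissible_prefix unfolding critical_def by blast
  have "overwriter l \<notin> txns (U @ P)" using fresh(2) P(1) l by auto
  from overwrite[OF UP l this] obtain W where W: "txns W \<subseteq> {overwriter l}"
    "admissible ((U @ P) @ W)" "committed ((U @ P) @ W) (overwriter l)"
    "(overwriter l, Inv (Write (Z l) (new (Z l)))) \<in> set W" .
  have "updater l \<notin> txns W" using W(1) l by auto
  then have "prepared l ((U @ P) @ W)"
    unfolding prepared_def using P(2) W(3,4)
    by (intro conjI exI[of _ "U @ P"] exI[of _ e] exI[of _ W]) auto
  moreover have "prepared j (U @ (P @ W))" if "j < l" for j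
    using U(3)[OF that] by (rule prepared_append) (use P(1) W(1) that l in auto)
  ultimately have "prepared j ((U @ P) @ W)" if "j < Suc l" for j
    using that by (cases "j = l") simp_all
  moreover have "txns ((U @ P) @ W) \<subseteq> writers (Suc l)"
    using U(2) P(1) W(1) by (auto simp: lessThan_Suc)
  ultimately show ?case using W(2) by blast
qed

text \<open>Overwriter \<open>j\<close> has committed before the reader and the observer start, so
  \<open>opaque_cycle\<close> applies in both directions, with their roles exchanged.\<close>

lemma reads_agree:
  assumes E: "admissible (U @ R)" and j: "j < m" and U: "prepared j U"
    and fresh: "overwriter j \<notin> txns R" "reader \<notin> txns U" "observer \<notin> txns U"
    and R: "reader \<in> txns R" "observer \<in> txns R"
    and reads: "reads_in (U @ R) reader (X j) v" "reads_in (U @ R) observer (X j) v'"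
  shows "v = new (X j) \<longleftrightarrow> v' = new (X j)"
proof -
  let ?E = "U @ R" and ?u = "updater j" and ?w = "overwriter j"
  have ex: "execution M ?E" using E by (rule admissible_execution)
  from U obtain C V e where "U = C @ V" "critical j C e" unfolding prepared_def by blast
  then have u: "reads_in ?E ?u (Z j) (tobj_init M (Z j))"
    using reads_in_append[of C ?u "Z j" _ "V @ R"] unfolding critical_def by simp
  have w: "(?w, Inv (Write (Z j) (new (Z j)))) \<in> set ?E" "committed ?E ?w"
    using U fresh(1) committed_append unfolding prepared_def by auto
  have "t_complete U ?w" using U unfolding prepared_def t_complete_def by blast
  then have rt: "rt_prec ?E ?w reader" "rt_prec ?E ?w observer"
    using fresh R by (auto intro: rt_prec_appendI)
  have ne: "?w \<noteq> ?u" "reader \<noteq> ?u" "observer \<noteq> ?u" using j by auto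
  note cycle = opaque_cycle[OF opaque ex _ new _ new w]
  show ?thesis
  proof
    assume v: "v = new (X j)"
    show "v' = new (X j)"
      by (rule cycle[OF _ _ rt(2) u ne(1) _ ne(2) reads(2) ne(3)])
        (use admissible_writes[OF E j] v reads(1) in auto)
  next
    assume v: "v' = new (X j)"
    show "v = new (X j)"
      by (rule cycle[OF _ _ rt(1) u ne(1) _ ne(3) reads(1) ne(2)])
        (use admissible_writes[OF E j] v reads(2) in auto)
  qed
qed

text \<open>
  Steps \<open>D\<close> inserted before the first write of a blind operation go unnoticed: the write
  overwrites whatever the operation reads afterwards.
\<close>

lemma insert_unnoticed:
  assumes op: "admissible (B @ op_run k opn (F\<^sub>1 @ F\<^sub>2) res)" and D: "admissible (B @ D)"
    and F: "prims_of k F\<^sub>1" "prims_of k F\<^sub>2" "\<And>b. trivial_on F\<^sub>1 b" "blind None F\<^sub>2"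
    and k: "proc_of k \<notin> procs D"
  shows "admissible (B @ ((k, Inv opn) # F\<^sub>1) @ D @ F\<^sub>2 @ [(k, Resp res)])" (is "admissible ?E")
proof -
  let ?I = "(k, Inv opn) # F\<^sub>1"
  let ?c = "conf M (B @ ?I)"
  have op': "admissible ((B @ ?I) @ F\<^sub>2 @ [(k, Resp res)])" using op by simp
  have procs: "procs F\<^sub>1 \<subseteq> {proc_of k}" using prims_of_txns[OF F(1)] by (auto simp: procs_def)
  \<comment> \<open>The invocation and \<open>F\<^sub>1\<close> change only the local state of a
    process that takes no step in \<open>D\<close>.\<close>
  have "agree (procs D) UNIV (conf M B) (after M (conf M B) ?I)"
  proof (rule agree_after)
    show "procs D \<inter> procs ?I = {}" using procs k by auto
    show "trivial_on ?I b" for b using F(3)[of b] by (auto simp: trivial_on_def)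
  qed
  moreover have "run_from M (conf M B) D" using D by (simp add: admissible_def)
  ultimately have run_D: "run_from M ?c D" using agree_run by fastforce
  have run_F: "run_from M ?c F\<^sub>2" and run_R: "run_from M (after M ?c F\<^sub>2) [(k, Resp res)]"
    using op' unfolding admissible_def run_from_append by blast+
  \<comment> \<open>For a run that is blind from \<open>None\<close>, agreement on the local state
    is enough, whatever \<open>D\<close> does to the memory.\<close>
  have "proc_state ?c (proc_of k) = proc_state (after M ?c D) (proc_of k)"
    using proc_state_after[OF k] by metis
  from blind_run[OF run_F F(4,2) this] have "run_from M (after M ?c D) F\<^sub>2"
    "proc_state (after M ?c F\<^sub>2) (proc_of k) = proc_state (after M (after M ?c D) F\<^sub>2) (proc_of k)"
    by auto
  with run_R have "run_from M (after M ?c D) (F\<^sub>2 @ [(k, Resp res)])"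
    unfolding run_from_append by simp
  with run_D op' have run: "run_from M (init_config M) ?E" by (simp add: admissible_def)
  have kD: "k \<notin> txns D" using k by (auto simp: procs_def)
  have wf: "wf_acts None (proj ?E k')" for k'
  proof (cases "k' = k")
    case True
    with kD have "proj ?E k' = proj (B @ op_run k opn (F\<^sub>1 @ F\<^sub>2) res) k'" by simp
    with op show ?thesis unfolding admissible_def by metis
  next
    case False
    have "k' \<notin> txns F\<^sub>1" "k' \<notin> txns F\<^sub>2"
      using False prims_of_txns[OF F(1)] prims_of_txns[OF F(2)] by auto
    with False have "proj ?E k' = proj (B @ D) k'" by simp
    with D show ?thesis unfolding admissible_def by metis
  qed
  have "set ?E \<subseteq> set (B @ op_run k opn (F\<^sub>1 @ F\<^sub>2) res) \<union> set (B @ D)" by auto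
  then have "allowed k' opn'" if "(k', Inv opn') \<in> set ?E" for k' opn'
    using that op D unfolding admissible_def by blast
  with run wf show ?thesis unfolding admissible_def by blast
qed

section \<open>Every read of the reader contains a pattern\<close>

lemma Dset_cases:
  assumes "admissible E" "j < m" "X j \<in> Dset E k"
  shows "k = updater j \<or> k = observer \<or> k = reader \<and> (reader, Inv (Read (X j))) \<in> set E"
proof -
  from assms(3) consider "(k, Inv (Read (X j))) \<in> set E" | v where "(k, Inv (Write (X j) v)) \<in> set E"
    unfolding Dset_def Rset_def Wset_def by blast
  then show ?thesis
  proof cases
    case 1
    moreover have "allowed k (Read (X j))" using 1 assms(1) unfolding admissible_def by blast
    ultimately show ?thesis using inj(3) assms(2) unfolding allowed_def by auto
  next
    case 2
    then show ?thesis using admissible_writes(1)[OF assms(1,2)] by blast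
  qed
qed

text \<open>Without a pattern, the part of the read from its first nontrivial primitive on is blind,
  so observer steps can be inserted there. Two insertions are compared: the observer alone returns
  an old value, the observer after \<open>e\<close> returns the new one. The reader returns the same
  \<open>v\<close> in both and would have to agree with each.\<close>

lemma read_has_pattern:
  assumes j: "j < m" and U: "prepared j U" "txns U \<subseteq> writers m"
    and S: "admissible (U @ S)" "txns S \<subseteq> {reader}" "(reader, Inv (Read (X j))) \<notin> set S"
    and op: "prims_of reader F" "admissible ((U @ S) @ op_run reader (Read (X j)) F (Val v))"
  shows "has_pattern reader (op_run reader (Read (X j)) F (Val v))"
proof (rule ccontr)
  assume no_pattern: "\<not> ?thesis"
  let ?triv = "\<lambda>e. \<forall>b pr r. snd e = Prim b pr r \<longrightarrow> trivial_prim pr"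
  let ?rd = "op_run reader (Read (X j)) F (Val v)"
  \<comment> \<open>The cut is right before the first nontrivial primitive; if there is none,
    \<open>F\<^sub>2\<close> is empty.\<close>
  define F\<^sub>1 F\<^sub>2 where F_def: "F\<^sub>1 = takeWhile ?triv F" "F\<^sub>2 = dropWhile ?triv F"
  have F_split: "F = F\<^sub>1 @ F\<^sub>2" by (simp add: F_def)
  then have prims: "prims_of reader F\<^sub>1" "prims_of reader F\<^sub>2" using op(1) by simp_all
  have triv: "trivial_on F\<^sub>1 b" for b
    unfolding trivial_on_def F_def by (auto dest!: set_takeWhileD)
  have "blind None F\<^sub>2"
  proof (rule blind_if_no_pattern)
    show "\<not> has_pattern reader (((reader, Inv (Read (X j))) # F\<^sub>1) @ F\<^sub>2 @ [(reader, Resp (Val v))])"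
      using no_pattern by (simp add: F_split)
    show "prims_of reader F\<^sub>2" by (rule prims)
    show "\<exists>b pr r. hd F\<^sub>2 = (reader, Prim b pr r) \<and> nontrivial_prim pr"
      if "F\<^sub>2 \<noteq> []"
    proof -
      have "hd F\<^sub>2 \<in> set F\<^sub>2" using that by (rule hd_in_set)
      with prims(2) obtain b pr r where "hd F\<^sub>2 = (reader, Prim b pr r)"
        unfolding prims_of_def by blast
      moreover have "\<not> ?triv (hd F\<^sub>2)"
        unfolding F_def by (rule hd_dropWhile) (use that F_def in simp)
      ultimately show ?thesis by auto
    qed
  qed auto
  note insert = insert_unnoticed[OF _ _ prims triv this, of "U @ S" "Read (X j)" "Val v"]
  from U(1) obtain C e V where C: "U = C @ V" "critical j C e" "updater j \<notin> txns V"
    unfolding prepared_def by blast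
  have US: "U @ S = C @ (V @ S)" using C(1) by simp
  have fresh: "observer \<notin> txns (U @ S)" "overwriter j \<notin> txns S" "reader \<notin> txns U"
    "updater j \<notin> txns S"
    using U(2) S(2) j by auto
  \<comment> \<open>Data sets are dynamic: until the reader invokes its read of \<open>X j\<close>,
    its data set lacks \<open>X j\<close>, and its earlier steps do not disturb the
    observer.\<close>
  then have no_read: "(reader, Inv (Read (X j))) \<notin> set (U @ S)"
    using S(3) by (force simp: txns_def)
  have disj: "X j \<notin> Dset (C @ (V @ S)) k" if "k \<in> txns (V @ S)" for k
    using Dset_cases[OF S(1) j, of k] no_read that fresh(1,4) C(1,3) by auto
  have "updater j \<notin> txns (V @ S)" using C(3) fresh(4) by simp
  from critical_transfer[OF S(1)[unfolded US] fresh(1)[unfolded US] j C(2) this disj]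
  obtain D\<^sub>1 v\<^sub>1 D\<^sub>2 where D: "prims_of observer D\<^sub>1" "prims_of observer D\<^sub>2"
    "v\<^sub>1 \<noteq> new (X j)" "fst e = updater j"
    "admissible ((U @ S) @ op_run observer (Read (X j)) D\<^sub>1 (Val v\<^sub>1))"
    "admissible ((U @ S) @ e # op_run observer (Read (X j)) D\<^sub>2 (Val (new (X j))))"
    unfolding US by blast
  \<comment> \<open>\<open>es\<close> is empty for the first insertion and \<open>[e]\<close> for
    the second.\<close>
  have contra: "v = new (X j) \<longleftrightarrow> v' = new (X j)"
    if D: "admissible ((U @ S) @ D)" "D = es @ op_run observer (Read (X j)) G (Val v')"
      "prims_of observer G" "txns es \<subseteq> {updater j}" for D es G v'
  proof -
    have tD: "txns D \<subseteq> {observer, updater j}" "observer \<in> txns D"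
      using D(2,4) prims_of_txns[OF D(3)] by auto
    then have "proc_of reader \<notin> procs D" using j by (auto simp: procs_def)
    from insert[OF op(2)[unfolded F_split] D(1) this]
    have E: "admissible ((U @ S) @ ((reader, Inv (Read (X j))) # F\<^sub>1) @ D @ F\<^sub>2 @ [(reader, Resp (Val v))])"
      (is "admissible ?E") .
    define R where "R = S @ ((reader, Inv (Read (X j))) # F\<^sub>1) @ D @ F\<^sub>2 @ [(reader, Resp (Val v))]"
    have ER: "?E = U @ R" by (simp add: R_def)
    \<comment> \<open>The reader takes exactly the steps of its original read, so it still returns
      \<open>v\<close>.\<close>
    have "reader \<notin> txns D" using tD(1) j by auto
    then have "proj ?E reader = proj ((U @ S) @ ?rd @ []) reader" by (simp add: F_split)
    from reads_in_cong[OF proj_history_cong[OF this]]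
    have r: "reads_in ?E reader (X j) v" using reads_in_op_run[OF op(1)] by metis
    have "observer \<notin> txns F\<^sub>1" "observer \<notin> txns F\<^sub>2" "observer \<notin> txns es"
      using prims_of_txns[OF prims(1)] prims_of_txns[OF prims(2)] D(4) j by auto
    then have "proj ?E observer = proj ((U @ S @ es) @ op_run observer (Read (X j)) G (Val v') @ []) observer"
      by (simp add: D(2))
    from reads_in_cong[OF proj_history_cong[OF this]]
    have o: "reads_in ?E observer (X j) v'" using reads_in_op_run[OF D(3)] by metis
    have "overwriter j \<notin> txns R"
      using fresh(2) tD(1) prims_of_txns[OF prims(1)] prims_of_txns[OF prims(2)] j
      by (auto simp: R_def)
    moreover have "reader \<in> txns R" "observer \<in> txns R" using tD(2) by (simp_all add: R_def)
    ultimately show ?thesis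
      using reads_agree[OF E[unfolded ER] j U(1) _ fresh(3) _ _ _ r[unfolded ER] o[unfolded ER]] fresh(1)
      by simp
  qed
  have "v = new (X j) \<longleftrightarrow> v\<^sub>1 = new (X j)"
    by (rule contra[OF D(5) _ D(1), of "[]"]) simp_all
  moreover have "v = new (X j) \<longleftrightarrow> new (X j) = new (X j)"
    by (rule contra[OF D(6) _ D(2), of "[e]"]) (simp_all add: D(4))
  ultimately show False using D(3) by blast
qed

text \<open>Each further read adds a pattern after the earlier ones. The set of objects already read
  is tracked because \<open>read_has_pattern\<close> needs the next one to be fresh.\<close>

lemma reading_phase:
  assumes U: "admissible U" "txns U \<subseteq> writers m" "\<And>j. j < m \<Longrightarrow> prepared j U" and "l \<le> m"
  shows "\<exists>S. admissible (U @ S) \<and> txns S \<subseteq> {reader} \<and> idle (U @ S) reader \<and>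
    (\<forall>x. (reader, Inv (Read x)) \<in> set S \<longleftrightarrow> x \<in> X ` {..<l}) \<and> performs_RAW_AWARs (U @ S) reader l"
  using assms(4)
proof (induction l)
  case 0
  have "reader \<notin> txns U" using U(2) by auto
  then have "idle U reader" by (simp add: idle_def)
  moreover have "performs_RAW_AWARs U reader 0"
    unfolding performs_RAW_AWARs_def by (intro exI[of _ "{}"]) simp
  ultimately show ?case using U(1) by (intro exI[of _ "[]"]) simp
next
  case (Suc l)
  then obtain S where S: "admissible (U @ S)" "txns S \<subseteq> {reader}" "idle (U @ S) reader"
    "\<And>x. (reader, Inv (Read x)) \<in> set S \<longleftrightarrow> x \<in> X ` {..<l}" "performs_RAW_AWARs (U @ S) reader l"
    by auto
  have l: "l < m" using Suc.prems by simp
  have fresh: "reader \<notin> txns U" using U(2) by auto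
  have "allowed reader (Read (X l))" using l by (auto simp: allowed_def)
  from admissible_read[OF S(1) fresh S(2,3) this] obtain F v where
    F: "prims_of reader F" "admissible (U @ S @ op_run reader (Read (X l)) F (Val v))" .
  let ?D = "op_run reader (Read (X l)) F (Val v)"
  have "X l \<notin> X ` {..<l}"
  proof
    assume "X l \<in> X ` {..<l}"
    then obtain i where "i < l" "X l = X i" by blast
    with inj(1)[of l i] l show False by simp
  qed
  then have "(reader, Inv (Read (X l))) \<notin> set S" using S(4) by blast
  from read_has_pattern[OF l U(3)[OF l] U(2) S(1,2) this F(1)] F(2)
  have "has_pattern reader ?D" by simp
  from performs_RAW_AWARs_append[OF S(5) this]
  have "performs_RAW_AWARs (U @ (S @ ?D)) reader (Suc l)" by simp
  moreover have "idle (U @ (S @ ?D)) reader"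
    using idle_op_run[of "Val v" "U @ S" reader "Read (X l)" F] by simp
  moreover have "txns (S @ ?D) \<subseteq> {reader}" using S(2) prims_of_txns[OF F(1)] by auto
  moreover have "(reader, Inv (Read x)) \<in> set (S @ ?D) \<longleftrightarrow> x \<in> X ` {..<Suc l}" for x
    using S(4)[of x] prims_of_inv[OF F(1)] by (auto simp: lessThan_Suc)
  ultimately show ?case using F(2) by (intro exI[of _ "S @ ?D"]) simp
qed

lemma reader_performs_patterns:
  assumes "0 < m"
  shows "\<exists>E. execution M E \<and> reader \<in> txns E \<and> read_only E reader \<and> performs_RAW_AWARs E reader m"
proof -
  obtain U where U: "admissible U" "txns U \<subseteq> writers m" "\<And>j. j < m \<Longrightarrow> prepared j U"
    using prepared_exists[of m] by auto
  from reading_phase[OF this order_refl] obtain S where S: "admissible (U @ S)"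
    "\<And>x. (reader, Inv (Read x)) \<in> set S \<longleftrightarrow> x \<in> X ` {..<m}" "performs_RAW_AWARs (U @ S) reader m"
    by blast
  \<comment> \<open>With \<open>0 < m\<close> there is at least one read, so the reader occurs in
    the execution.\<close>
  have "(reader, Inv (Read (X 0))) \<in> set S" using S(2) assms by blast
  then have "reader \<in> txns (U @ S)" by (force simp: txns_def)
  moreover have "read_only (U @ S) reader"
  proof -
    have "\<not> allowed reader (Write x v)" for x v unfolding allowed_def by auto
    then show ?thesis using S(1) unfolding read_only_def Wset_def admissible_def by blast
  qed
  ultimately show ?thesis using S(1,3) admissible_execution by blast
qed

end

section \<open>Choice of the objects and the asymptotic bound\<close>

lemma enough_objects:
  fixes A :: "'a set"
  assumes "infinite A \<or> card A \<ge> n" "k \<le> n"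
  obtains h where "inj_on h {..<k}" "h ` {..<k} \<subseteq> A"
proof -
  obtain B where B: "finite B" "card B = k" "B \<subseteq> A"
  proof (cases "finite A")
    case True
    with assms have "k \<le> card A" by auto
    then show thesis using obtain_subset_with_card_n[of k A] that by metis
  next
    case False
    then show thesis using infinite_arbitrarily_large[of A k] that by metis
  qed
  then obtain h where "bij_betw h {0..<k} B" using ex_bij_betw_nat_finite by blast
  with B(3) show thesis by (intro that[of h]) (auto simp: bij_betw_def atLeast0LessThan)
qed

lemma many_patterns:
  fixes M :: "('l, 'b, 's, 'r, 'x, 'v) tm"
  assumes vals: "\<exists>v w :: 'v. v \<noteq> w" and m: "0 < m" "2 * m + 2 \<le> nprocs M"
    and objs: "infinite (tobjs M) \<or> card (tobjs M) \<ge> nprocs M"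
    and M: "OF_progress M" "OF_liveness M" "opaque M" "RW_DAP M"
  shows "\<exists>E T. execution M E \<and> T \<in> txns E \<and> read_only E T \<and> performs_RAW_AWARs E T m"
proof -
  \<comment> \<open>Of the \<open>2 * m\<close> distinct objects the first half serves as
    \<open>X\<close>, the second half as \<open>Z\<close>.\<close>
  obtain h where h: "inj_on h {..<2 * m}" "h ` {..<2 * m} \<subseteq> tobjs M"
    using enough_objects[OF objs, of "2 * m"] m(2) by auto
  have inj: "h i = h j \<longleftrightarrow> i = j" if "i < 2 * m" "j < 2 * m" for i j
    using h(1) that by (auto simp: inj_on_def)
  have "\<exists>v. v \<noteq> tobj_init M x" for x using vals by metis
  then obtain new where new: "\<And>x. new x \<noteq> tobj_init M x" by metis
  interpret of_tm M m h "\<lambda>j. h (m + j)" new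
    using m(2) h(2) inj new M by unfold_locales auto
  show ?thesis using reader_performs_patterns[OF m(1)] by blast
qed

text \<open>Covers fewer than four processes, where the bound is zero: a lone invocation of
  \<open>tryC\<close> is read-only and accesses no t-object.\<close>

lemma read_only_exists:
  assumes "1 \<le> nprocs M"
  shows "\<exists>E T. execution M E \<and> T \<in> txns E \<and> read_only E T \<and> performs_RAW_AWARs E T 0"
proof (intro exI conjI)
  let ?E = "[((0, 0), Inv TryC)]"
  show "execution M ?E" using assms by (simp add: execution_def well_formed_def)
  show "(0, 0) \<in> txns ?E" by simp
  show "read_only ?E (0, 0)" by (simp add: read_only_def Wset_def)
  show "performs_RAW_AWARs ?E (0, 0) 0"
    unfolding performs_RAW_AWARs_def by (intro exI[of _ "{}"]) simp
qed

theorem theorem6: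
  assumes "\<exists>v w :: 'v. v \<noteq> w"
  shows "\<exists>f :: nat \<Rightarrow> nat. (\<lambda>n. real (f n)) \<in> \<Omega>(\<lambda>n. real n) \<and>
    (\<forall>(M :: ('l, 'b, 's, 'r, 'x, 'v) tm) n.
       nprocs M = n \<and> n \<ge> 1 \<and> (infinite (tobjs M) \<or> card (tobjs M) \<ge> n) \<and>
       OF_progress M \<and> OF_liveness M \<and> opaque M \<and> RW_DAP M \<longrightarrow>
       (\<exists>E T N. execution M E \<and> T \<in> txns E \<and> read_only E T \<and>
          performs_RAW_AWARs E T N \<and> N \<ge> f n))"
proof (intro exI[of _ "\<lambda>n. n div 2 - 1"] conjI allI impI)
  show "(\<lambda>n. real (n div 2 - 1)) \<in> \<Omega>(\<lambda>n. real n)"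
  \<comment> \<open>Any factor below 1/2 works for large \<open>n\<close>; for 1/6,
    \<open>n \<ge> 6\<close> is large enough.\<close>
  proof (rule landau_omega.bigI[of "1 / 6"])
    have "1 / 6 * norm (real n) \<le> norm (real (n div 2 - 1))" if "n \<ge> 6" for n
    proof -
      have "n \<le> 2 * (n div 2) + 1" "3 \<le> n div 2" using that by linarith+
      then have "real n \<le> 6 * real (n div 2 - 1)" by (simp add: of_nat_diff)
      then show ?thesis by simp
    qed
    then show "\<forall>\<^sub>F n in at_top. 1 / 6 * norm (real n) \<le> norm (real (n div 2 - 1))"
      by (rule eventually_at_top_linorderI[of 6])
  qed simp
next
  fix M :: "('l, 'b, 's, 'r, 'x, 'v) tm" and n
  assume M: "nprocs M = n \<and> n \<ge> 1 \<and> (infinite (tobjs M) \<or> card (tobjs M) \<ge> n) \<and>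
    OF_progress M \<and> OF_liveness M \<and> opaque M \<and> RW_DAP M"
  \<comment> \<open>For \<open>n \<ge> 2\<close> this is the largest \<open>m\<close> with
    \<open>2 * m + 2 \<le> n\<close>; for \<open>n = 1\<close> truncated subtraction gives
    0.\<close>
  let ?m = "n div 2 - 1"
  have "\<exists>E T. execution M E \<and> T \<in> txns E \<and> read_only E T \<and> performs_RAW_AWARs E T ?m"
  proof (cases "?m = 0")
    case True
    then show ?thesis using read_only_exists[of M] M by simp
  next
    case False
    then have "2 * ?m + 2 \<le> nprocs M" using M by simp
    with False M show ?thesis using many_patterns[OF assms, of ?m M] by blast
  qed
  then show "\<exists>E T N. execution M E \<and> T \<in> txns E \<and> read_only E T \<and>
      performs_RAW_AWARs E T N \<and> N \<ge> n div 2 - 1" by blast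
qed

end
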